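(* Let $1\le\alpha\le\infty$ and $0<\epsilon<1/4$. Consider the promise problem of deciding, for $n$-qubit pure states $|\psi_0\rangle,|\psi_1\rangle$, whether $\mathrm{T}_\alpha(|\psi_0\rangle\langle\psi_0|,|\psi_1\rangle\langle\psi_1|)$ is at least $\epsilon$ or exactly $0$. In the worst case over such pairs of states: (1) (Queries) in the purified quantum access model, the quantum query complexity of this problem is $\Omega(1/\epsilon)$; (2) (Samples) the quantum sample complexity of this problem is $\Omega(1/\epsilon^2)$.
   Context: $\mathrm{T}_\alpha(\rho_0,\rho_1)=\frac12\big(\mathrm{tr}(|\rho_0-\rho_1|^\alpha)\big)^{1/\alpha}$ for finite $\alpha$ and $\mathrm{T}_\infty(\rho_0,\rho_1)=\frac12\|\rho_0-\rho_1\|$ (operator norm). Purified quantum access model: the algorithm makes queries to unitaries $Q_0,Q_1$ (and their inverses and controlled versions) such that running $Q_b$ on the all-zero state and tracing out the non-output qubits gives the state indexed by $b$. Query complexity is the number of queries. Sample complexity is the number of copies of the states needed. Algorithms must answer correctly with probability at least $2/3$. *)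

theory Defs
  imports
    "Jordan_Normal_Form.Schur_Decomposition"
    "HOL-Library.Extended_Real"
begin

section \<open>Linear algebra\<close>

definition unitary_mat :: "nat \<Rightarrow> complex mat \<Rightarrow> bool" where
  "unitary_mat d U \<longleftrightarrow> U \<in> carrier_mat d d \<and>
     U * mat_adjoint U = 1\<^sub>m d \<and> mat_adjoint U * U = 1\<^sub>m d"

text \<open>The order on \<^typ>\<open>complex\<close> makes \<open>0 \<le> z\<close> say that \<open>z\<close> is real and nonnegative.\<close>

definition psd_mat :: "nat \<Rightarrow> complex mat \<Rightarrow> bool" where
  "psd_mat d A \<longleftrightarrow> A \<in> carrier_mat d d \<and> (\<forall>v\<in>carrier_vec d. 0 \<le> (A *\<^sub>v v) \<bullet>c v)"

definition mat_trace :: "complex mat \<Rightarrow> complex" where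
  "mat_trace A = (\<Sum>i<dim_row A. A $$ (i, i))"

definition cvec_norm :: "complex vec \<Rightarrow> real" where
  "cvec_norm v = sqrt (Re (v \<bullet>c v))"

definition operator_norm :: "complex mat \<Rightarrow> real" where
  "operator_norm A = (SUP v \<in> {v \<in> carrier_vec (dim_col A). cvec_norm v = 1}. cvec_norm (A *\<^sub>v v))"

text \<open>Real power of a positive semidefinite matrix by functional calculus, with \<open>0\<close> raised to
  any power being \<open>0\<close>.  The matrix \<open>B\<close> does not depend on the spectral decomposition
  \<open>A = U diag(l) U*\<close>, so the choice is harmless; for matrices that are not positive semidefinite
  the value is unspecified.\<close>

definition psd_powr :: "complex mat \<Rightarrow> real \<Rightarrow> complex mat" where
  "psd_powr A s = (SOME B. \<exists>U (l :: nat \<Rightarrow> real).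
     unitary_mat (dim_row A) U \<and> (\<forall>i<dim_row A. 0 \<le> l i) \<and>
     A = U * mat_diag (dim_row A) (\<lambda>i. complex_of_real (l i)) * mat_adjoint U \<and>
     B = U * mat_diag (dim_row A) (\<lambda>i. complex_of_real (l i powr s)) * mat_adjoint U)"

definition mat_abs :: "complex mat \<Rightarrow> complex mat" where
  "mat_abs A = psd_powr (mat_adjoint A * A) (1 / 2)"

text \<open>Kronecker product; the left factor is the most significant part of an index.\<close>

definition kron :: "complex mat \<Rightarrow> complex mat \<Rightarrow> complex mat" where
  "kron A B = mat (dim_row A * dim_row B) (dim_col A * dim_col B)
     (\<lambda>(i, j). A $$ (i div dim_row B, j div dim_col B) * B $$ (i mod dim_row B, j mod dim_col B))"

fun kron_power :: "complex mat \<Rightarrow> nat \<Rightarrow> complex mat" where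
  "kron_power A 0 = 1\<^sub>m 1"
| "kron_power A (Suc k) = kron A (kron_power A k)"

text \<open>Trace over the second factor of \<open>C^a \<otimes> C^b\<close>.\<close>

definition partial_trace :: "nat \<Rightarrow> nat \<Rightarrow> complex mat \<Rightarrow> complex mat" where
  "partial_trace a b M = mat a a (\<lambda>(i, j). \<Sum>k<b. M $$ (i * b + k, j * b + k))"

section \<open>States, measurements and the distance\<close>

definition pure_state :: "nat \<Rightarrow> complex vec \<Rightarrow> bool" where
  "pure_state n \<psi> \<longleftrightarrow> \<psi> \<in> carrier_vec (2 ^ n) \<and> cvec_norm \<psi> = 1"

definition ketbra :: "complex vec \<Rightarrow> complex mat" where
  "ketbra \<psi> = mat (dim_vec \<psi>) (dim_vec \<psi>) (\<lambda>(i, j). \<psi> $ i * cnj (\<psi> $ j))"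

text \<open>A two-outcome measurement \<open>{E, 1 - E}\<close> is given by the effect \<open>E\<close> of its outcome ``yes''.\<close>

definition effect :: "nat \<Rightarrow> complex mat \<Rightarrow> bool" where
  "effect d E \<longleftrightarrow> psd_mat d E \<and> psd_mat d (1\<^sub>m d - E)"

definition outcome_prob :: "complex mat \<Rightarrow> complex mat \<Rightarrow> real" where
  "outcome_prob E \<rho> = Re (mat_trace (E * \<rho>))"

definition T_dist :: "ereal \<Rightarrow> complex mat \<Rightarrow> complex mat \<Rightarrow> real" where
  "T_dist \<alpha> \<rho>0 \<rho>1 =
     (if \<alpha> = \<infinity> then operator_norm (\<rho>0 - \<rho>1) / 2
      else Re (mat_trace (psd_powr (mat_abs (\<rho>0 - \<rho>1)) (real_of_ereal \<alpha>)))
             powr (1 / real_of_ereal \<alpha>) / 2)"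

text \<open>The answer ``yes'', given by the measurement outcome \<open>E\<close>, claims that the distance is at
  least \<open>\<epsilon>\<close>; the answer ``no'' claims that it is \<open>0\<close>. Nothing is required off the promise.\<close>

definition answers_correctly ::
  "ereal \<Rightarrow> real \<Rightarrow> complex vec \<Rightarrow> complex vec \<Rightarrow> nat \<Rightarrow> complex mat \<Rightarrow> complex mat \<Rightarrow> bool" where
  "answers_correctly \<alpha> \<epsilon> \<psi>0 \<psi>1 d E \<rho> \<longleftrightarrow>
     (T_dist \<alpha> (ketbra \<psi>0) (ketbra \<psi>1) \<ge> \<epsilon> \<longrightarrow> outcome_prob E \<rho> \<ge> 2 / 3) \<and>
     (T_dist \<alpha> (ketbra \<psi>0) (ketbra \<psi>1) = 0 \<longrightarrow> outcome_prob (1\<^sub>m d - E) \<rho> \<ge> 2 / 3)"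

section \<open>Purified quantum query access\<close>

text \<open>The output register consists of the first \<open>n\<close> qubits, the purifying register of the last
  \<open>m\<close> ones.\<close>

definition purified_access :: "nat \<Rightarrow> nat \<Rightarrow> complex mat \<Rightarrow> complex mat \<Rightarrow> bool" where
  "purified_access n m Q \<rho> \<longleftrightarrow> unitary_mat (2 ^ (n + m)) Q \<and>
     partial_trace (2 ^ n) (2 ^ m) (ketbra (Q *\<^sub>v unit_vec (2 ^ (n + m)) 0)) = \<rho>"

datatype query = Query (to_second: bool) (inverted: bool) (controlled: bool)

text \<open>The qubits of an algorithm are arranged as: one control qubit, the query register on which
  the oracles act, the workspace. A controlled query is controlled by the control qubit; an
  uncontrolled one leaves it alone. Acting on fixed positions is no restriction, since arbitrary
  unitaries on all qubits are allowed between the queries.\<close>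

definition query_gate :: "nat \<Rightarrow> complex mat \<Rightarrow> complex mat \<Rightarrow> query \<Rightarrow> complex mat" where
  "query_gate w Q0 Q1 q =
     (let Q = (if to_second q then Q1 else Q0);
          V = (if inverted q then mat_adjoint Q else Q);
          N = dim_row V;
          C = (if controlled q then 1\<^sub>m N else V)
      in kron (four_block_mat C (0\<^sub>m N N) (0\<^sub>m N N) V) (1\<^sub>m (2 ^ w)))"

text \<open>Each round is a query followed by a unitary independent of the oracles.\<close>

record query_algorithm =
  work_qubits :: nat
  first_unitary :: "complex mat"
  rounds :: "(query \<times> complex mat) list"
  final_effect :: "complex mat"

definition total_dim :: "nat \<Rightarrow> nat \<Rightarrow> query_algorithm \<Rightarrow> nat" where
  "total_dim n m \<A> = 2 ^ (1 + (n + m) + work_qubits \<A>)"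

definition valid_query_algorithm :: "nat \<Rightarrow> nat \<Rightarrow> query_algorithm \<Rightarrow> bool" where
  "valid_query_algorithm n m \<A> \<longleftrightarrow>
     unitary_mat (total_dim n m \<A>) (first_unitary \<A>) \<and>
     (\<forall>(q, U) \<in> set (rounds \<A>). unitary_mat (total_dim n m \<A>) U) \<and>
     effect (total_dim n m \<A>) (final_effect \<A>)"

definition final_state ::
  "nat \<Rightarrow> nat \<Rightarrow> query_algorithm \<Rightarrow> complex mat \<Rightarrow> complex mat \<Rightarrow> complex vec" where
  "final_state n m \<A> Q0 Q1 =
     foldl (\<lambda>v (q, U). U *\<^sub>v (query_gate (work_qubits \<A>) Q0 Q1 q *\<^sub>v v))
       (first_unitary \<A> *\<^sub>v unit_vec (total_dim n m \<A>) 0) (rounds \<A>)"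

definition solves_with_queries ::
  "nat \<Rightarrow> nat \<Rightarrow> ereal \<Rightarrow> real \<Rightarrow> query_algorithm \<Rightarrow> bool" where
  "solves_with_queries n m \<alpha> \<epsilon> \<A> \<longleftrightarrow> valid_query_algorithm n m \<A> \<and>
     (\<forall>\<psi>0 \<psi>1 Q0 Q1. pure_state n \<psi>0 \<longrightarrow> pure_state n \<psi>1 \<longrightarrow>
        purified_access n m Q0 (ketbra \<psi>0) \<longrightarrow> purified_access n m Q1 (ketbra \<psi>1) \<longrightarrow>
        answers_correctly \<alpha> \<epsilon> \<psi>0 \<psi>1 (total_dim n m \<A>) (final_effect \<A>)
          (ketbra (final_state n m \<A> Q0 Q1)))"

text \<open>Both complexities are \<open>\<infinity>\<close> if there is no algorithm at all.\<close>

definition query_complexity :: "nat \<Rightarrow> nat \<Rightarrow> ereal \<Rightarrow> real \<Rightarrow> enat" where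
  "query_complexity n m \<alpha> \<epsilon> =
     Inf {enat (length (rounds \<A>)) | \<A>. solves_with_queries n m \<alpha> \<epsilon> \<A>}"

section \<open>Sample access\<close>

text \<open>An algorithm using \<open>k0\<close> copies of the first state and \<open>k1\<close> copies of the second is an
  arbitrary joint measurement; this subsumes auxiliary qubits and adaptive processing.\<close>

definition solves_with_samples ::
  "nat \<Rightarrow> ereal \<Rightarrow> real \<Rightarrow> nat \<Rightarrow> nat \<Rightarrow> complex mat \<Rightarrow> bool" where
  "solves_with_samples n \<alpha> \<epsilon> k0 k1 E \<longleftrightarrow> effect (2 ^ (n * (k0 + k1))) E \<and>
     (\<forall>\<psi>0 \<psi>1. pure_state n \<psi>0 \<longrightarrow> pure_state n \<psi>1 \<longrightarrow>
        answers_correctly \<alpha> \<epsilon> \<psi>0 \<psi>1 (2 ^ (n * (k0 + k1))) E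
          (kron (kron_power (ketbra \<psi>0) k0) (kron_power (ketbra \<psi>1) k1)))"

definition sample_complexity :: "nat \<Rightarrow> ereal \<Rightarrow> real \<Rightarrow> enat" where
  "sample_complexity n \<alpha> \<epsilon> = Inf {enat (k0 + k1) | k0 k1 E. solves_with_samples n \<alpha> \<epsilon> k0 k1 E}"

end

theory Submission
  imports Defs "HOL-Analysis.L2_Norm"
begin

text \<open>The hard pair is \<open>e\<^sub>0\<close> and \<open>c e\<^sub>0 + s e\<^sub>1\<close>
  with \<open>s = 2 \<epsilon>\<close>, to be told apart from the equal pair \<open>e\<^sub>0,
  e\<^sub>0\<close>. The difference \<open>D\<close> of the projections satisfies \<open>D\<^sup>2
  = s\<^sup>2 P\<close> with \<open>P\<close> the projection onto the first two coordinates, so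
  the distance is at least \<open>s / 2\<close> for every \<open>\<alpha>\<close>. The equal pair
  is prepared by identity oracles; replacing the second one by a rotation by the angle
  \<open>arccos c\<close> changes each query gate by at most \<open>sqrt (2 - 2 c)\<close> in
  norm, hence the final state of \<open>T\<close> queries by at most \<open>T sqrt (2 - 2 c) = O(T
  \<epsilon>)\<close>. With \<open>k\<close> copies of the second state the two product states
  have inner product \<open>c\<^sup>k\<close>, hence squared distance at most \<open>2 k (1 - c) =
  O(k \<epsilon>\<^sup>2)\<close>. Both distances have to be bounded below by a constant, since
  one measurement answers differently on the two states with probability
  \<open>2/3\<close>.\<close>

section \<open>Norms of vectors and bounded matrices\<close>

lemma sum_lessThan_mult:
  fixes f :: "nat \<Rightarrow> 'a::comm_monoid_add"
  shows "(\<Sum>i<a * b. f i) = (\<Sum>i<a. \<Sum>k<b. f (i * b + k))"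
proof -
  have "sum f {i * b..<i * b + b} = (\<Sum>k<b. f (i * b + k))" for i
    using sum.shift_bounds_nat_ivl[of f 0 "i * b" b] by (simp add: atLeast0LessThan add.commute)
  then show ?thesis by (simp add: sum.nat_group[symmetric])
qed

lemma pair_index_less:
  fixes i k a b :: nat
  assumes "i < a" "k < b"
  shows "i * b + k < a * b"
proof -
  have "i * b + k < (i + 1) * b" using assms by simp
  also have "\<dots> \<le> a * b" using assms by (intro mult_right_mono) auto
  finally show ?thesis .
qed

lemma dim_mat_adjoint [simp]:
  "dim_row (mat_adjoint A) = dim_col A" "dim_col (mat_adjoint A) = dim_row A"
  by (simp_all add: mat_adjoint_def)

lemma mat_adjoint_index [simp]:
  fixes A :: "complex mat"
  assumes "i < dim_col A" "j < dim_row A"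
  shows "mat_adjoint A $$ (i, j) = cnj (A $$ (j, i))"
  using assms by (simp add: mat_adjoint_def mat_of_rows_def)

lemma cscalar_prod_sum:
  fixes v w :: "complex vec"
  assumes "v \<in> carrier_vec d" "w \<in> carrier_vec d"
  shows "v \<bullet>c w = (\<Sum>i<d. v $ i * cnj (w $ i))"
  using assms by (simp add: scalar_prod_def atLeast0LessThan)

lemma mult_mat_vec_index_sum:
  assumes "A \<in> carrier_mat a b" "v \<in> carrier_vec b" "i < a"
  shows "(A *\<^sub>v v) $ i = (\<Sum>j<b. A $$ (i, j) * v $ j)"
  using assms by (simp add: scalar_prod_def atLeast0LessThan)

lemma times_mat_index_sum:
  assumes "A \<in> carrier_mat a b" "B \<in> carrier_mat b c" "i < a" "j < c"
  shows "(A * B) $$ (i, j) = (\<Sum>k<b. A $$ (i, k) * B $$ (k, j))"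
  using assms by (simp add: scalar_prod_def atLeast0LessThan)

section \<open>Euclidean norm and its unitary invariance\<close>

lemma cvec_norm_L2_set: "cvec_norm v = L2_set (\<lambda>i. cmod (v $ i)) {..<dim_vec v}"
  by (simp add: cvec_norm_def L2_set_def cscalar_prod_sum[of _ "dim_vec v"] complex_mult_cnj cmod_power2)

lemma cvec_norm_sq: "(cvec_norm v)\<^sup>2 = (\<Sum>i<dim_vec v. (cmod (v $ i))\<^sup>2)"
  by (simp add: cvec_norm_L2_set L2_set_def sum_nonneg)

lemma cvec_norm_sq_cscalar: "(cvec_norm v)\<^sup>2 = Re (v \<bullet>c v)"
  by (simp add: cvec_norm_sq cscalar_prod_sum[of _ "dim_vec v"] complex_mult_cnj cmod_power2)

lemma cvec_norm_nonneg [simp]: "0 \<le> cvec_norm v"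
  by (simp add: cvec_norm_L2_set)

lemma cvec_norm_uminus [simp]: "cvec_norm (- v) = cvec_norm v"
  by (auto simp: cvec_norm_L2_set intro!: L2_set_cong)

lemma cvec_norm_triangle:
  assumes "v \<in> carrier_vec d" "w \<in> carrier_vec d"
  shows "cvec_norm (v + w) \<le> cvec_norm v + cvec_norm w"
proof -
  have "cvec_norm (v + w) = L2_set (\<lambda>i. cmod (v $ i + w $ i)) {..<d}"
    using assms by (auto simp: cvec_norm_L2_set intro!: L2_set_cong)
  also have "\<dots> \<le> L2_set (\<lambda>i. cmod (v $ i) + cmod (w $ i)) {..<d}"
    by (intro L2_set_mono norm_triangle_ineq) simp
  also have "\<dots> \<le> cvec_norm v + cvec_norm w"
    using L2_set_triangle_ineq assms by (simp add: cvec_norm_L2_set)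
  finally show ?thesis .
qed

lemma cscalar_prod_mat_adjoint:
  fixes A :: "complex mat"
  assumes A: "A \<in> carrier_mat a b" and v: "v \<in> carrier_vec b" and w: "w \<in> carrier_vec a"
  shows "(A *\<^sub>v v) \<bullet>c w = v \<bullet>c (mat_adjoint A *\<^sub>v w)"
proof -
  have A': "mat_adjoint A \<in> carrier_mat b a" using A by auto
  have "(A *\<^sub>v v) \<bullet>c w = (\<Sum>i<a. \<Sum>j<b. A $$ (i, j) * v $ j * cnj (w $ i))"
    using A v w by (simp add: cscalar_prod_sum[of _ a] mult_mat_vec_index_sum[of A a b] sum_distrib_right
        del: index_mult_mat_vec)
  also have "\<dots> = (\<Sum>j<b. \<Sum>i<a. A $$ (i, j) * v $ j * cnj (w $ i))"
    by (rule sum.swap)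
  also have "\<dots> = v \<bullet>c (mat_adjoint A *\<^sub>v w)"
    using A A' v w by (simp add: cscalar_prod_sum[of _ b] mult_mat_vec_index_sum[of _ b a] sum_distrib_left
        mult_ac del: index_mult_mat_vec)
  finally show ?thesis .
qed

lemma cvec_norm_unitary:
  assumes U: "unitary_mat d U" and v: "v \<in> carrier_vec d"
  shows "cvec_norm (U *\<^sub>v v) = cvec_norm v"
proof -
  have c: "U \<in> carrier_mat d d" "mat_adjoint U \<in> carrier_mat d d" and e: "mat_adjoint U * U = 1\<^sub>m d"
    using U by (auto simp: unitary_mat_def)
  have "(U *\<^sub>v v) \<bullet>c (U *\<^sub>v v) = v \<bullet>c (mat_adjoint U *\<^sub>v (U *\<^sub>v v))"
    using c v by (simp add: cscalar_prod_mat_adjoint[of U d d])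
  also have "mat_adjoint U *\<^sub>v (U *\<^sub>v v) = v"
    using c v e by (simp add: assoc_mult_mat_vec[symmetric, of _ d d _ d])
  finally show ?thesis by (simp add: cvec_norm_def)
qed

text \<open>An operator norm bound stated vector by vector, so that no supremum has to be
  handled.\<close>

definition bounded_mat :: "nat \<Rightarrow> real \<Rightarrow> complex mat \<Rightarrow> bool" where
  "bounded_mat d K A \<longleftrightarrow>
     A \<in> carrier_mat d d \<and> (\<forall>v\<in>carrier_vec d. cvec_norm (A *\<^sub>v v) \<le> K * cvec_norm v)"

lemma bounded_mat_sqI:
  assumes "A \<in> carrier_mat d d" "0 \<le> K"
    and "\<And>v. v \<in> carrier_vec d \<Longrightarrow> (cvec_norm (A *\<^sub>v v))\<^sup>2 \<le> K\<^sup>2 * (cvec_norm v)\<^sup>2"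
  shows "bounded_mat d K A"
  unfolding bounded_mat_def
proof (intro conjI ballI)
  fix v :: "complex vec" assume v: "v \<in> carrier_vec d"
  show "cvec_norm (A *\<^sub>v v) \<le> K * cvec_norm v"
    by (rule power2_le_imp_le) (use assms v in \<open>simp_all add: power_mult_distrib\<close>)
qed (use assms in auto)

lemma bounded_mat_sqD:
  assumes "bounded_mat d K A" "v \<in> carrier_vec d"
  shows "(cvec_norm (A *\<^sub>v v))\<^sup>2 \<le> K\<^sup>2 * (cvec_norm v)\<^sup>2"
proof -
  have "cvec_norm (A *\<^sub>v v) \<le> K * cvec_norm v" using assms by (simp add: bounded_mat_def)
  from power_mono[OF this, of 2] show ?thesis by (simp add: power_mult_distrib)
qed

lemma bounded_mat_unitary: "unitary_mat d U \<Longrightarrow> bounded_mat d 1 U"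
  by (auto simp: bounded_mat_def cvec_norm_unitary) (simp add: unitary_mat_def)

lemma bounded_mat_one: "bounded_mat d 1 (1\<^sub>m d)"
  by (simp add: bounded_mat_def)

lemma bounded_mat_zero: "0 \<le> K \<Longrightarrow> bounded_mat d K (0\<^sub>m d d)"
  by (auto simp: bounded_mat_def cvec_norm_L2_set L2_set_def intro!: mult_nonneg_nonneg sum_nonneg)

section \<open>Norm bounds for tensor products and block sums\<close>

lemma kron_one_carrier [simp]:
  "A \<in> carrier_mat a c \<Longrightarrow> kron A (1\<^sub>m b) \<in> carrier_mat (a * b) (c * b)"
  by (auto simp: kron_def)

text \<open>The entries of \<open>v\<close> with a fixed second index \<open>k\<close> form a slice;
  tensoring \<open>A\<close> with the identity makes it act on every slice separately.\<close>

lemma kron_one_mult_vec: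
  assumes A: "A \<in> carrier_mat a a" and v: "v \<in> carrier_vec (a * b)" and i: "i < a" and k: "k < b"
  shows "(kron A (1\<^sub>m b) *\<^sub>v v) $ (i * b + k) = (A *\<^sub>v vec a (\<lambda>j. v $ (j * b + k))) $ i"
proof -
  have "(kron A (1\<^sub>m b) *\<^sub>v v) $ (i * b + k)
      = (\<Sum>j<a. \<Sum>l<b. kron A (1\<^sub>m b) $$ (i * b + k, j * b + l) * v $ (j * b + l))"
    using A v pair_index_less[OF i k]
    by (simp add: mult_mat_vec_index_sum[of _ "a * b" "a * b"] sum_lessThan_mult del: index_mult_mat_vec)
  also have "\<dots> = (\<Sum>j<a. \<Sum>l<b. if l = k then A $$ (i, j) * v $ (j * b + k) else 0)"
    using A i k pair_index_less by (intro sum.cong refl) (auto simp: kron_def)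
  also have "\<dots> = (A *\<^sub>v vec a (\<lambda>j. v $ (j * b + k))) $ i"
    using A i k by (simp add: mult_mat_vec_index_sum[of _ a a] del: index_mult_mat_vec)
  finally show ?thesis .
qed

text \<open>The slices of \<open>v\<close> have disjoint supports, so their squared norms add up,
  and \<open>A\<close> enlarges each of these by a factor of at most
  \<open>K\<^sup>2\<close>.\<close>

lemma bounded_mat_kron_one:
  assumes A: "bounded_mat a K A" and K: "0 \<le> K"
  shows "bounded_mat (a * b) K (kron A (1\<^sub>m b))"
proof (rule bounded_mat_sqI)
  show "kron A (1\<^sub>m b) \<in> carrier_mat (a * b) (a * b)" using A by (simp add: bounded_mat_def)
  fix v :: "complex vec" assume v: "v \<in> carrier_vec (a * b)"
  define w where "w k = vec a (\<lambda>j. v $ (j * b + k))" for k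
  have [simp]: "w k \<in> carrier_vec a" "dim_vec (w k) = a" for k by (auto simp: w_def)
  have c: "A \<in> carrier_mat a a" using A by (simp add: bounded_mat_def)
  have "(cvec_norm (kron A (1\<^sub>m b) *\<^sub>v v))\<^sup>2
      = (\<Sum>i<a. \<Sum>k<b. (cmod ((kron A (1\<^sub>m b) *\<^sub>v v) $ (i * b + k)))\<^sup>2)"
    using c by (simp add: cvec_norm_sq sum_lessThan_mult kron_def del: index_mult_mat_vec)
  also have "\<dots> = (\<Sum>i<a. \<Sum>k<b. (cmod ((A *\<^sub>v w k) $ i))\<^sup>2)"
    using c v by (intro sum.cong refl) (simp add: kron_one_mult_vec w_def del: index_mult_mat_vec)
  also have "\<dots> = (\<Sum>k<b. (cvec_norm (A *\<^sub>v w k))\<^sup>2)"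
    using c by (subst sum.swap) (simp add: cvec_norm_sq del: index_mult_mat_vec)
  also have "\<dots> \<le> (\<Sum>k<b. K\<^sup>2 * (cvec_norm (w k))\<^sup>2)"
    by (intro sum_mono bounded_mat_sqD[OF A]) simp
  also have "(\<Sum>k<b. K\<^sup>2 * (cvec_norm (w k))\<^sup>2) = K\<^sup>2 * (\<Sum>i<a. \<Sum>k<b. (cmod (v $ (i * b + k)))\<^sup>2)"
    by (subst sum.swap) (simp add: cvec_norm_sq sum_distrib_left w_def)
  also have "\<dots> = K\<^sup>2 * (cvec_norm v)\<^sup>2"
    using v by (simp add: cvec_norm_sq sum_lessThan_mult)
  finally show "(cvec_norm (kron A (1\<^sub>m b) *\<^sub>v v))\<^sup>2 \<le> K\<^sup>2 * (cvec_norm v)\<^sup>2" .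
qed (rule K)

lemma cvec_norm_append: "(cvec_norm (v @\<^sub>v w))\<^sup>2 = (cvec_norm v)\<^sup>2 + (cvec_norm w)\<^sup>2"
proof -
  let ?n = "dim_vec v" and ?f = "\<lambda>i. (cmod ((v @\<^sub>v w) $ i))\<^sup>2"
  have "(cvec_norm (v @\<^sub>v w))\<^sup>2 = sum ?f {0..<?n} + sum ?f {?n..<?n + dim_vec w}"
    by (simp add: cvec_norm_sq lessThan_atLeast0 sum.atLeastLessThan_concat del: index_append_vec(1))
  also have "sum ?f {?n..<?n + dim_vec w} = (\<Sum>i<dim_vec w. ?f (?n + i))"
    using sum.shift_bounds_nat_ivl[of ?f 0 ?n "dim_vec w"] by (simp add: atLeast0LessThan add.commute)
  finally show ?thesis by (simp add: cvec_norm_sq atLeast0LessThan)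
qed

text \<open>The two halves of a vector are treated independently and their squared norms add up.
  Gates governed by the control qubit have this block shape.\<close>

lemma bounded_mat_block_diag:
  assumes A: "bounded_mat a K A" and B: "bounded_mat a K B" and K: "0 \<le> K"
  shows "bounded_mat (a + a) K (four_block_mat A (0\<^sub>m a a) (0\<^sub>m a a) B)"
proof (rule bounded_mat_sqI)
  have c: "A \<in> carrier_mat a a" "B \<in> carrier_mat a a" using A B by (simp_all add: bounded_mat_def)
  then show "four_block_mat A (0\<^sub>m a a) (0\<^sub>m a a) B \<in> carrier_mat (a + a) (a + a)" by simp
  fix v :: "complex vec" assume v: "v \<in> carrier_vec (a + a)"
  define x y where "x = vec_first v a" and "y = vec_last v a"
  have xy: "x \<in> carrier_vec a" "y \<in> carrier_vec a" by (simp_all add: x_def y_def)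
  have v_eq: "v = x @\<^sub>v y" using v by (simp add: x_def y_def)
  have "four_block_mat A (0\<^sub>m a a) (0\<^sub>m a a) B *\<^sub>v v = (A *\<^sub>v x) @\<^sub>v (B *\<^sub>v y)"
    unfolding v_eq using c xy by (rule mult_mat_vec_split)
  then show "(cvec_norm (four_block_mat A (0\<^sub>m a a) (0\<^sub>m a a) B *\<^sub>v v))\<^sup>2 \<le> K\<^sup>2 * (cvec_norm v)\<^sup>2"
    using bounded_mat_sqD[OF A xy(1)] bounded_mat_sqD[OF B xy(2)]
    by (simp add: v_eq cvec_norm_append algebra_simps)
qed (rule K)

section \<open>Gates close to the identity\<close>

text \<open>The two bounds have separate roles in the hybrid argument: contraction keeps earlier
  errors from growing, and \<open>K\<close> limits the error that a gate adds.\<close>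

definition near_one :: "nat \<Rightarrow> real \<Rightarrow> complex mat \<Rightarrow> bool" where
  "near_one d K V \<longleftrightarrow> bounded_mat d 1 V \<and> bounded_mat d K (V - 1\<^sub>m d)"

lemma near_one_contraction:
  "near_one d K V \<Longrightarrow> v \<in> carrier_vec d \<Longrightarrow> cvec_norm (V *\<^sub>v v) \<le> cvec_norm v"
  by (simp add: near_one_def bounded_mat_def)

lemma near_one_one: "0 \<le> K \<Longrightarrow> near_one d K (1\<^sub>m d)"
proof -
  assume K: "0 \<le> K"
  have "1\<^sub>m d - 1\<^sub>m d = (0\<^sub>m d d :: complex mat)" by (rule eq_matI) auto
  with K show ?thesis unfolding near_one_def by (metis bounded_mat_one bounded_mat_zero)
qed

text \<open>The identity on a product is the \<open>kron\<close> of two identities, so it can be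
  subtracted inside the first factor, where the bound \<open>K\<close> is known.\<close>

lemma near_one_kron_one:
  assumes A: "near_one a K A" and K: "0 \<le> K"
  shows "near_one (a * b) K (kron A (1\<^sub>m b))"
proof -
  have c: "A \<in> carrier_mat a a" using A by (simp add: near_one_def bounded_mat_def)
  have "kron (A - 1\<^sub>m a) (1\<^sub>m b) = kron A (1\<^sub>m b) - 1\<^sub>m (a * b)"
  proof (rule eq_matI)
    fix i j assume "i < dim_row (kron A (1\<^sub>m b) - 1\<^sub>m (a * b))" "j < dim_col (kron A (1\<^sub>m b) - 1\<^sub>m (a * b))"
    then have ij: "i < a * b" "j < a * b" by simp_all
    then have b: "b > 0" by (cases b) auto
    have q: "i div b < a" "j div b < a" using ij by (simp_all add: less_mult_imp_div_less)
    \<comment> \<open>A product index is determined by its quotient and remainder, so the entries of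
      the identity can be compared factor by factor.\<close>
    have "i = j \<longleftrightarrow> i div b = j div b \<and> i mod b = j mod b" by (metis div_mult_mod_eq)
    then show "kron (A - 1\<^sub>m a) (1\<^sub>m b) $$ (i, j) = (kron A (1\<^sub>m b) - 1\<^sub>m (a * b)) $$ (i, j)"
      using ij b c q by (auto simp: kron_def)
  qed (use c in \<open>auto simp: kron_def\<close>)
  then show ?thesis
    using A K by (auto simp: near_one_def intro: bounded_mat_kron_one dest: bounded_mat_kron_one[where b = b])
qed

lemma near_one_block_diag:
  assumes A: "near_one a K A" and B: "near_one a K B" and K: "0 \<le> K"
  shows "near_one (a + a) K (four_block_mat A (0\<^sub>m a a) (0\<^sub>m a a) B)"
proof -
  have c: "A \<in> carrier_mat a a" "B \<in> carrier_mat a a" using A B by (simp_all add: near_one_def bounded_mat_def)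
  have "four_block_mat (A - 1\<^sub>m a) (0\<^sub>m a a) (0\<^sub>m a a) (B - 1\<^sub>m a)
      = four_block_mat A (0\<^sub>m a a) (0\<^sub>m a a) B - 1\<^sub>m (a + a)"
    using c by (intro eq_matI) auto
  then show ?thesis
    using bounded_mat_block_diag[of a 1 A B] bounded_mat_block_diag[of a K "A - 1\<^sub>m a" "B - 1\<^sub>m a"] A B K
    by (simp add: near_one_def)
qed

lemma mat_adjoint_mat_adjoint [simp]: "mat_adjoint (mat_adjoint A) = (A :: complex mat)"
  by (rule eq_matI) auto

lemma unitary_mat_adjoint: "unitary_mat d U \<Longrightarrow> unitary_mat d (mat_adjoint U)"
  by (auto simp: unitary_mat_def)

text \<open>For unitary \<open>U\<close> one has \<open>U* - 1 = -(U - 1) U*\<close>, and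
  \<open>U*\<close> preserves norms. Inverse queries are therefore as close to the identity as
  forward ones.\<close>

lemma near_one_adjoint:
  assumes U: "unitary_mat d U" and near: "near_one d K U"
  shows "near_one d K (mat_adjoint U)"
proof -
  have c: "U \<in> carrier_mat d d" "mat_adjoint U \<in> carrier_mat d d"
    and e: "U * mat_adjoint U = 1\<^sub>m d" and U': "unitary_mat d (mat_adjoint U)"
    using U unitary_mat_adjoint[OF U] by (auto simp: unitary_mat_def)
  have "bounded_mat d K (mat_adjoint U - 1\<^sub>m d)"
    unfolding bounded_mat_def
  proof (intro conjI ballI)
    fix v :: "complex vec" assume v: "v \<in> carrier_vec d"
    define w where "w = mat_adjoint U *\<^sub>v v"
    have w: "w \<in> carrier_vec d" using c v by (auto simp: w_def)
    have "(mat_adjoint U - 1\<^sub>m d) *\<^sub>v v = w - v"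
      using c v by (simp add: w_def minus_mult_distrib_mat_vec[of _ d d])
    also have v_eq: "v = U *\<^sub>v w"
      using c v e by (simp add: w_def assoc_mult_mat_vec[symmetric, of _ d d _ d])
    also have "w - U *\<^sub>v w = - ((U - 1\<^sub>m d) *\<^sub>v w)"
      using c w by (simp add: minus_mult_distrib_mat_vec[of _ d d]) (auto intro!: eq_vecI)
    finally have *: "(mat_adjoint U - 1\<^sub>m d) *\<^sub>v (U *\<^sub>v w) = - ((U - 1\<^sub>m d) *\<^sub>v w)" .
    have "cvec_norm ((mat_adjoint U - 1\<^sub>m d) *\<^sub>v v) = cvec_norm ((U - 1\<^sub>m d) *\<^sub>v w)"
      unfolding v_eq * by simp
    also have "\<dots> \<le> K * cvec_norm w" using near w by (simp add: near_one_def bounded_mat_def)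
    also have "cvec_norm w = cvec_norm v" using U' v by (simp add: w_def cvec_norm_unitary)
    finally show "cvec_norm ((mat_adjoint U - 1\<^sub>m d) *\<^sub>v v) \<le> K * cvec_norm v" .
  qed (rule minus_carrier_mat, simp)
  then show ?thesis using U' by (simp add: near_one_def bounded_mat_unitary)
qed

lemma near_one_query_gate:
  assumes "0 \<le> K" "unitary_mat d Q0" "near_one d K Q0" "unitary_mat d Q1" "near_one d K Q1"
  shows "near_one (2 * d * 2 ^ w) K (query_gate w Q0 Q1 q)"
proof -
  define Q where "Q = (if to_second q then Q1 else Q0)"
  define V where "V = (if inverted q then mat_adjoint Q else Q)"
  have "near_one d K V" unfolding V_def Q_def using assms by (auto intro: near_one_adjoint)
  moreover from this have "dim_row V = d" by (auto simp: near_one_def bounded_mat_def)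
  ultimately have "near_one (d + d) K
      (four_block_mat (if controlled q then 1\<^sub>m (dim_row V) else V)
        (0\<^sub>m (dim_row V) (dim_row V)) (0\<^sub>m (dim_row V) (dim_row V)) V)"
    using assms(1) by (auto intro!: near_one_block_diag near_one_one)
  then show ?thesis
    unfolding query_gate_def Let_def Q_def[symmetric] V_def[symmetric] mult_2
    using assms(1) by (rule near_one_kron_one)
qed

section \<open>The hybrid argument over the rounds\<close>

lemma hybrid_step:
  assumes V: "near_one d K V" and V': "near_one d K' V'" and v: "v \<in> carrier_vec d" "v' \<in> carrier_vec d"
    and "0 \<le> K" "0 \<le> K'" "cvec_norm v' \<le> 1"
  shows "cvec_norm (V *\<^sub>v v - V' *\<^sub>v v') \<le> cvec_norm (v - v') + (K + K')"
proof -
  have c: "V \<in> carrier_mat d d" "V' \<in> carrier_mat d d"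
    using V V' by (auto simp: near_one_def bounded_mat_def)
  have carr: "(V - 1\<^sub>m d) *\<^sub>v v' \<in> carrier_vec d" "(V' - 1\<^sub>m d) *\<^sub>v v' \<in> carrier_vec d"
    "V *\<^sub>v (v - v') \<in> carrier_vec d"
    using c v by (auto intro!: mult_mat_vec_carrier[of _ d d])
  \<comment> \<open>The old error is transported by \<open>V\<close>; the new error comes from
    comparing both gates with the identity on the same vector \<open>v'\<close>.\<close>
  have "V *\<^sub>v v - V' *\<^sub>v v' = V *\<^sub>v (v - v') + ((V - 1\<^sub>m d) *\<^sub>v v' + - ((V' - 1\<^sub>m d) *\<^sub>v v'))"
    using c v by (simp add: minus_mult_distrib_mat_vec[of _ d d] mult_minus_distrib_mat_vec[of _ d d])
      (auto intro!: eq_vecI)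
  also have "cvec_norm \<dots> \<le> cvec_norm (V *\<^sub>v (v - v'))
      + (cvec_norm ((V - 1\<^sub>m d) *\<^sub>v v') + cvec_norm (- ((V' - 1\<^sub>m d) *\<^sub>v v')))"
    using carr by (intro order_trans[OF cvec_norm_triangle[of _ d]] add_left_mono cvec_norm_triangle[of _ d])
      auto
  also have "cvec_norm (- ((V' - 1\<^sub>m d) *\<^sub>v v')) = cvec_norm ((V' - 1\<^sub>m d) *\<^sub>v v')"
    by simp
  also have "cvec_norm (V *\<^sub>v (v - v')) \<le> cvec_norm (v - v')"
    using v by (intro near_one_contraction[OF V]) simp
  also have "cvec_norm ((V - 1\<^sub>m d) *\<^sub>v v') \<le> K"
    using V v assms(5,7) mult_left_mono[of "cvec_norm v'" 1 K]
    by (fastforce simp: near_one_def bounded_mat_def)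
  also have "cvec_norm ((V' - 1\<^sub>m d) *\<^sub>v v') \<le> K'"
    using V' v assms(6,7) mult_left_mono[of "cvec_norm v'" 1 K']
    by (fastforce simp: near_one_def bounded_mat_def)
  finally show ?thesis by simp
qed

text \<open>The unitaries between the queries are shared by both runs and preserve distances, so
  each round adds only the \<open>K + K'\<close> of \<open>hybrid_step\<close>. The carrier and norm
  claims prepare for \<open>effect_discrimination\<close>.\<close>

lemma cvec_norm_foldl_queries:
  fixes K K' :: real
  assumes rounds: "\<And>U. U \<in> snd ` set rs \<Longrightarrow> unitary_mat d U"
    and G: "\<And>q. near_one d K (G q)" and G': "\<And>q. near_one d K' (G' q)"
    and K: "0 \<le> K" "0 \<le> K'"
    and v: "v \<in> carrier_vec d" "v' \<in> carrier_vec d" "cvec_norm v \<le> 1" "cvec_norm v' \<le> 1"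
  shows "foldl (\<lambda>v (q, U). U *\<^sub>v (G q *\<^sub>v v)) v rs \<in> carrier_vec d \<and>
     foldl (\<lambda>v (q, U). U *\<^sub>v (G' q *\<^sub>v v)) v' rs \<in> carrier_vec d \<and>
     cvec_norm (foldl (\<lambda>v (q, U). U *\<^sub>v (G q *\<^sub>v v)) v rs) \<le> 1 \<and>
     cvec_norm (foldl (\<lambda>v (q, U). U *\<^sub>v (G' q *\<^sub>v v)) v' rs) \<le> 1 \<and>
     cvec_norm (foldl (\<lambda>v (q, U). U *\<^sub>v (G q *\<^sub>v v)) v rs - foldl (\<lambda>v (q, U). U *\<^sub>v (G' q *\<^sub>v v)) v' rs)
       \<le> cvec_norm (v - v') + length rs * (K + K')"
  using rounds v
proof (induction rs arbitrary: v v')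
  case Nil
  then show ?case by simp
next
  case (Cons r rs)
  obtain q U where r: "r = (q, U)" by force
  have U: "unitary_mat d U" using Cons.prems(1) r by auto
  have c: "U \<in> carrier_mat d d" "G q \<in> carrier_mat d d" "G' q \<in> carrier_mat d d"
    using U G[of q] G'[of q] by (auto simp: unitary_mat_def near_one_def bounded_mat_def)
  have w: "G q *\<^sub>v v \<in> carrier_vec d" "G' q *\<^sub>v v' \<in> carrier_vec d" using c Cons.prems by auto
  have n: "cvec_norm (G q *\<^sub>v v) \<le> 1" "cvec_norm (G' q *\<^sub>v v') \<le> 1"
    using near_one_contraction[OF G] near_one_contraction[OF G'] Cons.prems(2-) order_trans by blast+
  have "cvec_norm (U *\<^sub>v (G q *\<^sub>v v) - U *\<^sub>v (G' q *\<^sub>v v')) = cvec_norm (G q *\<^sub>v v - G' q *\<^sub>v v')"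
    using c w U by (simp add: mult_minus_distrib_mat_vec[of U d d, symmetric] cvec_norm_unitary)
  also have "\<dots> \<le> cvec_norm (v - v') + (K + K')"
    using G G' Cons.prems K by (intro hybrid_step) auto
  finally have step: "cvec_norm (U *\<^sub>v (G q *\<^sub>v v) - U *\<^sub>v (G' q *\<^sub>v v')) \<le> cvec_norm (v - v') + (K + K')" .
  have Uw: "U *\<^sub>v (G q *\<^sub>v v) \<in> carrier_vec d" "U *\<^sub>v (G' q *\<^sub>v v') \<in> carrier_vec d"
    "cvec_norm (U *\<^sub>v (G q *\<^sub>v v)) \<le> 1" "cvec_norm (U *\<^sub>v (G' q *\<^sub>v v')) \<le> 1"
    using c w n U by (auto simp: cvec_norm_unitary)
  have len: "real (length (r # rs)) * (K + K') = (K + K') + length rs * (K + K')"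
    by (simp add: distrib_right)
  have rs: "unitary_mat d U'" if "U' \<in> snd ` set rs" for U'
    using Cons.prems(1) that by auto
  show ?case
    unfolding len using Cons.IH[OF rs Uw] step by (simp add: r)
qed

section \<open>Distinguishing two states by one measurement\<close>

lemma outcome_prob_ketbra:
  assumes "E \<in> carrier_mat d d" "v \<in> carrier_vec d"
  shows "outcome_prob E (ketbra v) = Re ((E *\<^sub>v v) \<bullet>c v)"
proof -
  have "mat_trace (E * ketbra v) = (\<Sum>i<d. \<Sum>j<d. E $$ (i, j) * (v $ j * cnj (v $ i)))"
    using assms by (simp add: mat_trace_def times_mat_index_sum[of _ d d _ d] ketbra_def
        del: index_mult_mat(1))
  also have "\<dots> = (E *\<^sub>v v) \<bullet>c v"
    using assms by (simp add: cscalar_prod_sum[of _ d] mult_mat_vec_index_sum[of _ d d] sum_distrib_right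
        mult.assoc del: index_mult_mat_vec(1))
  finally show ?thesis by (simp add: outcome_prob_def)
qed

text \<open>The inequality \<open>q(b) \<le> 3/2 q(a) + 3 q(b - a)\<close> for the nonnegative quadratic form \<open>q\<close> of an
  effect follows from the identity \<open>q(b) + q(3a - 2b)/2 = 3/2 q(a) + 3 q(b - a)\<close>.\<close>

lemma effect_discrimination:
  assumes E: "effect d E" and v: "v \<in> carrier_vec d" "w \<in> carrier_vec d" "cvec_norm v \<le> 1"
    and no: "outcome_prob (1\<^sub>m d - E) (ketbra v) \<ge> 2 / 3" and yes: "outcome_prob E (ketbra w) \<ge> 2 / 3"
  shows "1 / 18 \<le> (cvec_norm (w - v))\<^sup>2"
proof -
  have c: "E \<in> carrier_mat d d" using E by (auto simp: effect_def psd_mat_def)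
  \<comment> \<open>The sesquilinear form of \<open>E\<close>, taken on coordinate functions so that
    its expansion needs no carrier conditions.\<close>
  define B where "B x y = (\<Sum>i<d. \<Sum>j<d. E $$ (i, j) * x j * cnj (y i))" for x y :: "nat \<Rightarrow> complex"
  define Q where "Q x = Re ((E *\<^sub>v x) \<bullet>c x)" for x
  have Q_nonneg: "0 \<le> Q x" if "x \<in> carrier_vec d" for x
    using E that by (auto simp: effect_def psd_mat_def Q_def less_eq_complex_def)
  \<comment> \<open>Through this identity, positivity of \<open>1 - E\<close> becomes the upper
    bound \<open>Q_le\<close>.\<close>
  have Q_compl: "Re (((1\<^sub>m d - E) *\<^sub>v x) \<bullet>c x) = (cvec_norm x)\<^sup>2 - Q x" if x: "x \<in> carrier_vec d" for x
    using c x by (simp add: Q_def cvec_norm_sq_cscalar minus_mult_distrib_mat_vec[of _ d d]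
        minus_scalar_prod_distrib[of _ d])
  have Q_le: "Q x \<le> (cvec_norm x)\<^sup>2" if x: "x \<in> carrier_vec d" for x
    using E x Q_compl[OF x] by (fastforce simp: effect_def psd_mat_def less_eq_complex_def)
  have QB: "Q x = Re (B (\<lambda>i. x $ i) (\<lambda>i. x $ i))" if "x \<in> carrier_vec d" for x
    using c that by (simp add: Q_def B_def cscalar_prod_sum[of _ d] mult_mat_vec_index_sum[of _ d d]
        sum_distrib_right del: index_mult_mat_vec(1))
  have B_diff: "B (\<lambda>i. s * x i + t * y i) (\<lambda>i. s * x i + t * y i)
      = s\<^sup>2 * B x x + t\<^sup>2 * B y y + s * t * (B x y + B y x)"
    if "cnj s = s" "cnj t = t" for s t x y
    using that by (simp add: B_def algebra_simps sum.distrib sum_distrib_left power2_eq_square)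
  have "Q (w - v) = Re (B (\<lambda>i. 1 * w $ i + (-1) * v $ i) (\<lambda>i. 1 * w $ i + (-1) * v $ i))"
    using v by (subst QB) (auto simp: B_def intro!: arg_cong[of _ _ Re] sum.cong)
  then have 1: "Q (w - v) = Q w + Q v - Re (B w' v' + B v' w')"
    if "w' = (\<lambda>i. w $ i)" "v' = (\<lambda>i. v $ i)" for w' v'
    using v that by (simp only: B_diff complex_cnj_one complex_cnj_minus) (simp add: QB)
  have "Q (3 \<cdot>\<^sub>v v - 2 \<cdot>\<^sub>v w) = Re (B (\<lambda>i. 3 * v $ i + (-2) * w $ i) (\<lambda>i. 3 * v $ i + (-2) * w $ i))"
    using v by (subst QB) (auto simp: B_def intro!: arg_cong[of _ _ Re] sum.cong)
  then have 2: "Q (3 \<cdot>\<^sub>v v - 2 \<cdot>\<^sub>v w) = 9 * Q v + 4 * Q w - 6 * Re (B w' v' + B v' w')"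
    if "w' = (\<lambda>i. w $ i)" "v' = (\<lambda>i. v $ i)" for w' v'
    using v that by (subst (asm) B_diff) (simp_all add: QB)
  have "0 \<le> Q (3 \<cdot>\<^sub>v v - 2 \<cdot>\<^sub>v w)" "Q (w - v) \<le> (cvec_norm (w - v))\<^sup>2"
    using v by (auto intro!: Q_nonneg Q_le)
  moreover have "Q w \<ge> 2 / 3" using yes c v by (simp add: outcome_prob_ketbra[of _ d] Q_def)
  moreover have "Q v \<le> 1 / 3"
  proof -
    have "2 / 3 \<le> (cvec_norm v)\<^sup>2 - Q v"
      using no v(1) Q_compl outcome_prob_ketbra[of "1\<^sub>m d - E" d v] minus_carrier_mat[OF c] by simp
    moreover have "(cvec_norm v)\<^sup>2 \<le> 1" using v by (simp add: power_le_one)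
    ultimately show ?thesis by simp
  qed
  \<comment> \<open>Eliminating the cross term from facts 1 and 2 gives
    \<open>0 \<le> 3 * Q v - 2 * Q w + 6 * Q (w - v)\<close>. With \<open>Q v \<le> 1 / 3\<close>
    and \<open>Q w \<ge> 2 / 3\<close> this yields \<open>Q (w - v) \<ge> 1 / 18\<close>.\<close>
  ultimately show ?thesis using 1[OF refl refl] 2[OF refl refl] by simp
qed

section \<open>The hard pair of states\<close>

lemma mat_adjoint_one [simp]: "mat_adjoint (1\<^sub>m d) = (1\<^sub>m d :: complex mat)"
  by (rule eq_matI) auto

lemma unitary_mat_one: "unitary_mat d (1\<^sub>m d)"
  by (simp add: unitary_mat_def)

text \<open>Any decomposition \<open>U diag(l) U*\<close> of a matrix with \<open>A\<^sup>2 = b A\<close> has all \<open>l i\<close> in \<open>{0, b}\<close>,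
  and on these values \<open>x powr t\<close> is the linear function \<open>(b powr t / b) x\<close>.\<close>

lemma psd_powr_diag_indicator:
  assumes a: "0 \<le> a"
  shows "psd_powr (mat_diag d (\<lambda>i. complex_of_real (if P i then a else 0))) t
    = mat_diag d (\<lambda>i. complex_of_real (if P i then a powr t else 0))"
proof -
  define diag where "diag l = mat_diag d (\<lambda>i. complex_of_real (l i))" for l :: "nat \<Rightarrow> real"
  \<comment> \<open>For \<open>a = 0\<close> the matrix \<open>A\<close> is zero and
    \<open>A * A = b A\<close> holds for any \<open>b\<close>; the value 1 keeps \<open>b\<close>
    positive, so that dividing by it in \<open>k\<close> is sound.\<close>
  define b where "b = (if a = 0 then 1 else a)"
  define k where "k = b powr t / b"
  define A where "A = diag (\<lambda>i. if P i then a else 0)"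
  have diag_carrier [simp]: "diag l \<in> carrier_mat d d" for l by (simp add: diag_def)
  have diag_smult: "diag (\<lambda>i. x * l i) = complex_of_real x \<cdot>\<^sub>m diag l" for x l
    by (rule eq_matI) (auto simp: diag_def mat_diag_def)
  have diag_mult: "diag l * diag l' = diag (\<lambda>i. l i * l' i)" for l l'
    by (simp add: diag_def)
  have b: "b > 0" using a by (simp add: b_def)
  have AA: "A * A = complex_of_real b \<cdot>\<^sub>m A"
    unfolding A_def diag_mult diag_smult[symmetric]
    by (rule arg_cong[of _ _ diag]) (auto simp: b_def)
  have dimA: "dim_row A = d" by (simp add: A_def diag_def mat_diag_def)
  define R where "R B \<longleftrightarrow> (\<exists>U l. unitary_mat d U \<and> (\<forall>i<d. 0 \<le> l i) \<and>
     A = U * diag l * mat_adjoint U \<and> B = U * diag (\<lambda>i. l i powr t) * mat_adjoint U)" for B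
  have R_unique: "B = complex_of_real k \<cdot>\<^sub>m A" if RB: "R B" for B
  proof -
    obtain U l where U: "unitary_mat d U" and A_eq: "A = U * diag l * mat_adjoint U"
      and B_eq: "B = U * diag (\<lambda>i. l i powr t) * mat_adjoint U"
      using RB unfolding R_def by blast
    have c: "U \<in> carrier_mat d d" "mat_adjoint U \<in> carrier_mat d d"
      and e: "U * mat_adjoint U = 1\<^sub>m d" "mat_adjoint U * U = 1\<^sub>m d"
      using U unitary_mat_adjoint[OF U] by (auto simp: unitary_mat_def)
    have Ac: "A \<in> carrier_mat d d" by (simp add: A_def)
    have conj: "mat_adjoint U * (U * X * mat_adjoint U) * U = X" if X: "X \<in> carrier_mat d d" for X
    proof -
      have "mat_adjoint U * (U * X * mat_adjoint U) * U
          = (mat_adjoint U * U) * X * (mat_adjoint U * U)"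
        using c X by (simp add: assoc_mult_mat[of _ d d _ d _ d])
      then show ?thesis using X e by simp
    qed
    have conj_smult: "U * diag (\<lambda>i. x * l i) * mat_adjoint U
        = complex_of_real x \<cdot>\<^sub>m (U * diag l * mat_adjoint U)" for x
      unfolding diag_smult mult_smult_distrib[OF c(1) diag_carrier]
      by (rule mult_smult_assoc_mat[OF mult_carrier_mat[OF c(1) diag_carrier] c(2)])
    have "U * diag (\<lambda>i. l i * l i) * mat_adjoint U
        = U * diag l * (mat_adjoint U * U) * diag l * mat_adjoint U"
      unfolding e using c right_mult_one_mat[OF diag_carrier, of l]
      by (simp add: diag_mult[symmetric] assoc_mult_mat[of _ d d _ d _ d])
    also have "\<dots> = A * A" using c by (simp add: A_eq assoc_mult_mat[of _ d d _ d _ d] mult_carrier_mat[of _ d d _ d])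
    also have "\<dots> = U * diag (\<lambda>i. b * l i) * mat_adjoint U"
      unfolding AA unfolding A_eq conj_smult ..
    \<comment> \<open>Conjugation by \<open>U\<close> is injective by \<open>conj\<close>, so the
      relation between \<open>A * A\<close> and \<open>A\<close> descends to the diagonal.\<close>
    finally have "diag (\<lambda>i. l i * l i) = diag (\<lambda>i. b * l i)"
      by (metis conj diag_carrier)
    then have "complex_of_real (l i * l i) = complex_of_real (b * l i)" if "i < d" for i
      using that by (auto simp: diag_def mat_diag_def dest!: arg_cong[of _ _ "\<lambda>M. M $$ (i, i)"])
    then have "l i = 0 \<or> l i = b" if "i < d" for i
      using that by (metis mult_cancel_right of_real_eq_iff)
    \<comment> \<open>At \<open>l i = 0\<close> both sides vanish, since \<open>0 powr t = 0\<close>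
      for every \<open>t\<close>, including \<open>t = 0\<close>.\<close>
    then have "l i powr t = k * l i" if "i < d" for i
      using that b by (fastforce simp: k_def)
    then have "diag (\<lambda>i. l i powr t) = diag (\<lambda>i. k * l i)"
      by (intro eq_matI) (auto simp: diag_def mat_diag_def)
    then show ?thesis
      unfolding B_eq A_eq conj_smult[symmetric] by simp
  qed
  \<comment> \<open>Some decomposition must exist before the choice can be evaluated: the matrix is
    already diagonal, so the identity serves as \<open>U\<close>.\<close>
  have "R (1\<^sub>m d * diag (\<lambda>i. (if P i then a else 0) powr t) * mat_adjoint (1\<^sub>m d))"
    unfolding R_def by (rule exI[of _ "1\<^sub>m d"], rule exI[of _ "\<lambda>i. if P i then a else 0"])
      (use a in \<open>simp add: unitary_mat_one A_def left_mult_one_mat[OF diag_carrier]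
        right_mult_one_mat[OF diag_carrier]\<close>)
  then have "R (SOME B. R B)" by (rule someI)
  then have "psd_powr A t = complex_of_real k \<cdot>\<^sub>m A"
    unfolding psd_powr_def dimA R_def[symmetric, unfolded diag_def] by (rule R_unique)
  also have "\<dots> = diag (\<lambda>i. if P i then a powr t else 0)"
    unfolding A_def diag_smult[symmetric] k_def b_def by (rule arg_cong[of _ _ diag]) auto
  finally show ?thesis by (simp add: A_def diag_def)
qed

section \<open>Rotations in a coordinate plane as oracles\<close>

lemma sum_two_terms:
  fixes f :: "nat \<Rightarrow> 'a::comm_monoid_add"
  assumes "0 < p" "p < d" "\<And>i. i < d \<Longrightarrow> i \<noteq> 0 \<Longrightarrow> i \<noteq> p \<Longrightarrow> f i = 0"
  shows "(\<Sum>i<d. f i) = f 0 + f p"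
proof -
  have "(\<Sum>i<d. f i) = (\<Sum>i\<in>{0, p}. f i)"
    using assms by (intro sum.mono_neutral_right) auto
  then show ?thesis using assms by simp
qed

lemma cvec_norm_two_terms:
  assumes "v \<in> carrier_vec d" "0 < p" "p < d"
  shows "(cmod (v $ 0))\<^sup>2 + (cmod (v $ p))\<^sup>2 \<le> (cvec_norm v)\<^sup>2"
proof -
  have "(\<Sum>i\<in>{0, p}. (cmod (v $ i))\<^sup>2) \<le> (\<Sum>i<d. (cmod (v $ i))\<^sup>2)"
    using assms by (intro sum_mono2) auto
  then show ?thesis using assms by (simp add: cvec_norm_sq)
qed

text \<open>The matrix with rows \<open>(x, -y)\<close> and \<open>(y, x)\<close> is a scaled
  rotation. It covers both a rotation minus the identity, with \<open>x = c - 1\<close> and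
  \<open>y = s\<close>, and, up to a sign, the difference of the two projections, with
  \<open>x = s * s\<close> and \<open>y = c * s\<close>.\<close>

lemma cmod_rotation:
  "(cmod (of_real x * a - of_real y * b))\<^sup>2 + (cmod (of_real y * a + of_real x * b))\<^sup>2
    = (x\<^sup>2 + y\<^sup>2) * ((cmod a)\<^sup>2 + (cmod b)\<^sup>2)"
  unfolding cmod_power2 by (simp add: power2_eq_square algebra_simps)

text \<open>The second axis \<open>p\<close> is a parameter because an oracle acts on output and
  purifying register together: the output basis state 1 with purifier 0 has index
  \<open>2 ^ m\<close>.\<close>

definition plane_rotation :: "nat \<Rightarrow> nat \<Rightarrow> real \<Rightarrow> real \<Rightarrow> complex mat" where
  "plane_rotation d p c s = mat d d (\<lambda>(i, j).
     if i = 0 then (if j = 0 then of_real c else if j = p then - of_real s else 0)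
     else if i = p then (if j = 0 then of_real s else if j = p then of_real c else 0)
     else if i = j then 1 else 0)"

definition tilted_state :: "nat \<Rightarrow> real \<Rightarrow> real \<Rightarrow> complex vec" where
  "tilted_state d c s = vec d (\<lambda>i. if i = 0 then of_real c else if i = 1 then of_real s else 0)"

lemma plane_rotation_carrier [simp]: "plane_rotation d p c s \<in> carrier_mat d d"
  by (simp add: plane_rotation_def)

text \<open>The function \<open>f\<close> stands for the entries of a vector or for a column of a
  second matrix.\<close>

lemma plane_rotation_row_sum:
  assumes "0 < p" "p < d" "i < d"
  shows "(\<Sum>k<d. plane_rotation d p c s $$ (i, k) * f k)
    = (if i = 0 then of_real c * f 0 - of_real s * f p
       else if i = p then of_real s * f 0 + of_real c * f p else f i)"
proof (cases "i = 0 \<or> i = p")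
  case True
  then show ?thesis
    using assms by (subst sum_two_terms[of p]) (auto simp: plane_rotation_def)
next
  case False
  then have "(\<Sum>k<d. plane_rotation d p c s $$ (i, k) * f k) = (\<Sum>k<d. if k = i then f i else 0)"
    using assms by (intro sum.cong refl) (auto simp: plane_rotation_def)
  then show ?thesis using False assms by simp
qed

lemma plane_rotation_trivial: "plane_rotation d p 1 0 = 1\<^sub>m d"
  by (rule eq_matI) (auto simp: plane_rotation_def)

lemma plane_rotation_mult_inverse:
  assumes "0 < p" "p < d" "c\<^sup>2 + s\<^sup>2 = 1"
  shows "plane_rotation d p c s * plane_rotation d p c (- s) = 1\<^sub>m d"
proof (rule eq_matI)
  have eq: "complex_of_real c * of_real c + of_real s * of_real s = 1"
    using assms(3) by (simp add: power2_eq_square flip: of_real_mult of_real_add)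
  fix i j assume "i < dim_row (1\<^sub>m d)" "j < dim_col (1\<^sub>m d)"
  then show "(plane_rotation d p c s * plane_rotation d p c (- s)) $$ (i, j) = 1\<^sub>m d $$ (i, j)"
    using assms eq
    by (simp add: times_mat_index_sum[of _ d d _ d] plane_rotation_row_sum del: index_mult_mat(1))
      (auto simp: plane_rotation_def algebra_simps)
qed (auto simp: plane_rotation_def)

lemma unitary_mat_plane_rotation:
  assumes "0 < p" "p < d" "c\<^sup>2 + s\<^sup>2 = 1"
  shows "unitary_mat d (plane_rotation d p c s)"
proof -
  \<comment> \<open>The entries are real, so the adjoint is the transpose, which is the rotation by
    the opposite angle.\<close>
  have "mat_adjoint (plane_rotation d p c s) = plane_rotation d p c (- s)"
    by (rule eq_matI) (auto simp: plane_rotation_def)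
  then show ?thesis
    using plane_rotation_mult_inverse[of p d c s] plane_rotation_mult_inverse[of p d c "- s"] assms
    by (simp add: unitary_mat_def)
qed

text \<open>Minus the identity, the rotation vanishes off its plane and is a scaled rotation on it,
  with squared factor \<open>(c - 1)\<^sup>2 + s\<^sup>2 = 2 - 2 * c\<close>.\<close>

lemma near_one_plane_rotation:
  assumes "0 < p" "p < d" "c\<^sup>2 + s\<^sup>2 = 1"
  shows "near_one d (sqrt (2 - 2 * c)) (plane_rotation d p c s)"
  unfolding near_one_def
proof
  show "bounded_mat d 1 (plane_rotation d p c s)"
    using assms by (intro bounded_mat_unitary unitary_mat_plane_rotation)
  have "c\<^sup>2 \<le> 1" using assms(3) by (metis le_add_same_cancel1 zero_le_power2)
  then have c1: "c \<le> 1" by (rule power2_le_imp_le[of c 1, simplified])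
  let ?M = "plane_rotation d p c s - 1\<^sub>m d"
  show "bounded_mat d (sqrt (2 - 2 * c)) ?M"
  proof (rule bounded_mat_sqI)
    fix v :: "complex vec" assume v: "v \<in> carrier_vec d"
    have M: "(?M *\<^sub>v v) $ i = (if i = 0 then (of_real c - 1) * v $ 0 - of_real s * v $ p
        else if i = p then of_real s * v $ 0 + (of_real c - 1) * v $ p else 0)" if "i < d" for i
    proof -
      have "(?M *\<^sub>v v) $ i = (plane_rotation d p c s *\<^sub>v v) $ i - v $ i"
        using v that by (simp add: minus_mult_distrib_mat_vec[of _ d d] del: index_mult_mat_vec(1))
      also have "(plane_rotation d p c s *\<^sub>v v) $ i
          = (\<Sum>j<d. plane_rotation d p c s $$ (i, j) * v $ j)"
        using v that by (intro mult_mat_vec_index_sum) auto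
      finally show ?thesis
        using assms that by (simp add: plane_rotation_row_sum left_diff_distrib)
    qed
    have "(cvec_norm (?M *\<^sub>v v))\<^sup>2 = (cmod ((of_real c - 1) * v $ 0 - of_real s * v $ p))\<^sup>2
        + (cmod (of_real s * v $ 0 + (of_real c - 1) * v $ p))\<^sup>2"
      using assms M by (simp add: cvec_norm_sq sum_two_terms[of p] del: index_mult_mat_vec(1))
    also have "\<dots> = ((c - 1)\<^sup>2 + s\<^sup>2) * ((cmod (v $ 0))\<^sup>2 + (cmod (v $ p))\<^sup>2)"
      using cmod_rotation[of "c - 1" "v $ 0" s "v $ p"] by simp
    also have "(c - 1)\<^sup>2 + s\<^sup>2 = 2 - 2 * c"
      using assms(3) by (simp add: power2_eq_square algebra_simps)
    also have "(2 - 2 * c) * ((cmod (v $ 0))\<^sup>2 + (cmod (v $ p))\<^sup>2) \<le> (2 - 2 * c) * (cvec_norm v)\<^sup>2"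
      using c1 assms v by (intro mult_left_mono cvec_norm_two_terms) auto
    finally show "(cvec_norm (?M *\<^sub>v v))\<^sup>2 \<le> (sqrt (2 - 2 * c))\<^sup>2 * (cvec_norm v)\<^sup>2"
      using c1 by simp
  qed (use c1 in \<open>auto intro!: minus_carrier_mat\<close>)
qed

text \<open>The rotation sends the zero state to the tilted state tensored with the zero state of
  the purifying register. Tracing out that register leaves the pure projection.\<close>

lemma purified_access_plane_rotation:
  assumes n: "1 \<le> n" and cs: "c\<^sup>2 + s\<^sup>2 = 1"
  shows "purified_access n m (plane_rotation (2 ^ (n + m)) (2 ^ m) c s) (ketbra (tilted_state (2 ^ n) c s))"
proof -
  define d :: nat where "d = 2 ^ (n + m)"
  define b :: nat where "b = 2 ^ m"
  define u where "u = plane_rotation d b c s *\<^sub>v unit_vec d 0"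
  have d: "d = 2 ^ n * b" and b: "0 < b" by (simp_all add: d_def b_def power_add)
  have "(2::nat) ^ 1 \<le> 2 ^ n" using n by (intro power_increasing) auto
  then have "2 * b \<le> d" by (simp add: d)
  then have bd: "b < d" using b by simp
  have dim_u: "dim_vec u = d" by (simp add: u_def plane_rotation_def)
  have u: "u $ x = (if x = 0 then of_real c else if x = b then of_real s else 0)" if "x < d" for x
    using that bd b
    by (auto simp: u_def mult_mat_vec_index_sum[of _ d d] plane_rotation_row_sum simp del: index_mult_mat_vec(1))
  have lt: "i * b + k < d" if "i < 2 ^ n" "k < b" for i k
    unfolding d using that by (rule pair_index_less)
  \<comment> \<open>The product form of \<open>u\<close> in coordinates: only the purifier index
    \<open>k = 0\<close> carries weight.\<close>
  have ub: "u $ (i * b + k) = (if k = 0 then tilted_state (2 ^ n) c s $ i else 0)"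
    if "i < 2 ^ n" "k < b" for i k
  proof -
    have "i * b + k = 0 \<longleftrightarrow> i = 0 \<and> k = 0" using b by simp
    moreover have "i * b + k = b \<longleftrightarrow> i = 1 \<and> k = 0"
    proof
      assume eq: "i * b + k = b"
      then have "(i * b + k) div b = 1" "(i * b + k) mod b = 0" using b by simp_all
      then show "i = 1 \<and> k = 0" using that b by simp
    qed simp
    ultimately show ?thesis using u[OF lt[OF that]] that by (auto simp: tilted_state_def)
  qed
  have "partial_trace (2 ^ n) b (ketbra u) = ketbra (tilted_state (2 ^ n) c s)"
  proof (rule eq_matI)
    fix i j assume "i < dim_row (ketbra (tilted_state (2 ^ n) c s))" "j < dim_col (ketbra (tilted_state (2 ^ n) c s))"
    then have ij: "i < 2 ^ n" "j < 2 ^ n" by (simp_all add: ketbra_def tilted_state_def)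
    then have "partial_trace (2 ^ n) b (ketbra u) $$ (i, j)
        = (\<Sum>k<b. u $ (i * b + k) * cnj (u $ (j * b + k)))"
      using lt by (simp add: partial_trace_def ketbra_def dim_u)
    also have "\<dots> = (\<Sum>k<b. if k = 0 then ketbra (tilted_state (2 ^ n) c s) $$ (i, j) else 0)"
      using ij ub by (intro sum.cong refl) (auto simp: ketbra_def tilted_state_def)
    also have "\<dots> = ketbra (tilted_state (2 ^ n) c s) $$ (i, j)" using b by simp
    finally show "partial_trace (2 ^ n) b (ketbra u) $$ (i, j) = ketbra (tilted_state (2 ^ n) c s) $$ (i, j)" .
  qed (simp_all add: partial_trace_def ketbra_def tilted_state_def)
  moreover have "unitary_mat d (plane_rotation d b c s)"
    using b bd cs by (rule unitary_mat_plane_rotation)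
  ultimately show ?thesis
    unfolding purified_access_def u_def b_def[symmetric] d_def[symmetric] by simp
qed

section \<open>The hard states and their distance\<close>

lemma cscalar_prod_tilted_state:
  assumes "2 \<le> d"
  shows "tilted_state d c s \<bullet>c tilted_state d c' s' = of_real (c * c' + s * s')"
  using assms
  by (simp add: cscalar_prod_sum[of _ d] sum_two_terms[of 1] tilted_state_def)

lemma pure_state_tilted_state:
  assumes "1 \<le> n" "c\<^sup>2 + s\<^sup>2 = 1"
  shows "pure_state n (tilted_state (2 ^ n) c s)"
proof -
  have "(2::nat) ^ 1 \<le> 2 ^ n" using assms by (intro power_increasing) auto
  then show ?thesis
    using assms(2)
    by (simp add: pure_state_def cvec_norm_def cscalar_prod_tilted_state power2_eq_square)
      (simp add: tilted_state_def)
qed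

text \<open>The absolute value of the difference is \<open>s\<close> times a projection of rank two.
  This gives the trace \<open>2 * s powr r\<close>, and the operator norm \<open>s\<close> is
  attained on the range of that projection.\<close>

lemma T_dist_tilted_state:
  assumes d: "2 \<le> d" and cs: "c\<^sup>2 + s\<^sup>2 = 1" and s: "0 \<le> s"
  shows "T_dist \<alpha> (ketbra (tilted_state d 1 0)) (ketbra (tilted_state d c s))
    = (if \<alpha> = \<infinity> then s / 2
       else (2 * s powr real_of_ereal \<alpha>) powr (1 / real_of_ereal \<alpha>) / 2)"
proof -
  define D where "D = ketbra (tilted_state d 1 0) - ketbra (tilted_state d c s)"
  have D_carrier: "D \<in> carrier_mat d d"
    unfolding D_def by (rule minus_carrier_mat) (simp add: ketbra_def tilted_state_def)
  \<comment> \<open>Normalization turns the entry \<open>1 - c * c\<close> at \<open>(0, 0)\<close>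
    into \<open>s * s\<close>.\<close>
  have "c * c = 1 - s * s" using cs by (simp add: power2_eq_square)
  then have csC: "complex_of_real c * of_real c = 1 - of_real s * of_real s"
    by (metis of_real_mult of_real_diff of_real_1)
  have D: "D $$ (i, j) = (if i = 0 \<and> j = 0 then of_real s * of_real s
      else if i = 1 \<and> j = 1 then - of_real s * of_real s
      else if i = 0 \<and> j = 1 \<or> i = 1 \<and> j = 0 then - of_real c * of_real s else 0)"
    if "i < d" "j < d" for i j
    using that csC by (auto simp: D_def ketbra_def tilted_state_def)
  have D_adj: "mat_adjoint D = D"
    by (rule eq_matI) (use D_carrier in \<open>auto simp: D\<close>)
  have "D * D = mat_diag d (\<lambda>i. complex_of_real (if i < 2 then s\<^sup>2 else 0))"
  proof (rule eq_matI)
    fix i j assume "i < dim_row (mat_diag d (\<lambda>i. complex_of_real (if i < 2 then s\<^sup>2 else 0)))"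
      "j < dim_col (mat_diag d (\<lambda>i. complex_of_real (if i < 2 then s\<^sup>2 else 0)))"
    then have ij: "i < d" "j < d" by (simp_all add: mat_diag_def)
    have "(D * D) $$ (i, j) = (\<Sum>k<d. D $$ (i, k) * D $$ (k, j))"
      using D_carrier ij by (intro times_mat_index_sum)
    also have "\<dots> = D $$ (i, 0) * D $$ (0, j) + D $$ (i, 1) * D $$ (1, j)"
      using d ij by (intro sum_two_terms) (auto simp: D)
    \<comment> \<open>On the plane both diagonal entries are \<open>s^4 + c^2 s^2 = s^2\<close>, and
      the two off-diagonal products cancel.\<close>
    also have "\<dots> = (if i = j \<and> i < 2 then (complex_of_real s)\<^sup>2 else 0)"
    proof -
      have "complex_of_real s * of_real s * (of_real s * of_real s) + of_real c * of_real s * (of_real c * of_real s)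
          = (of_real s)\<^sup>2 * (of_real s * of_real s + of_real c * of_real c)"
        by (simp add: power2_eq_square algebra_simps)
      also have "\<dots> = (complex_of_real s)\<^sup>2" by (simp add: csC)
      finally show ?thesis using d ij by (auto simp: D add.commute less_2_cases_iff)
    qed
    finally show "(D * D) $$ (i, j) = mat_diag d (\<lambda>i. complex_of_real (if i < 2 then s\<^sup>2 else 0)) $$ (i, j)"
      using ij by (simp add: mat_diag_def)
  qed (use D_carrier in \<open>auto simp: mat_diag_def\<close>)
  moreover have "s\<^sup>2 powr (1 / 2) = s"
    using s by (simp only: powr_half_sqrt zero_le_power2 real_sqrt_abs abs_of_nonneg)
  ultimately have abs: "mat_abs D = mat_diag d (\<lambda>i. complex_of_real (if i < 2 then s else 0))"
    by (simp only: mat_abs_def D_adj psd_powr_diag_indicator zero_le_power2)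
  have trace: "mat_trace (psd_powr (mat_abs D) r) = of_real (2 * s powr r)" for r
  proof -
    have "mat_trace (psd_powr (mat_abs D) r) = (\<Sum>i<d. complex_of_real (if i < 2 then s powr r else 0))"
      unfolding abs psd_powr_diag_indicator[OF s] by (simp add: mat_trace_def mat_diag_def)
    also have "\<dots> = of_real (2 * s powr r)"
      using d by (subst sum_two_terms[of 1]) auto
    finally show ?thesis .
  qed
  have norm_D: "(cvec_norm (D *\<^sub>v v))\<^sup>2 = s\<^sup>2 * ((cmod (v $ 0))\<^sup>2 + (cmod (v $ 1))\<^sup>2)"
    if v: "v \<in> carrier_vec d" for v
  proof -
    have Dv: "(D *\<^sub>v v) $ i = D $$ (i, 0) * v $ 0 + D $$ (i, 1) * v $ 1" if "i < d" for i
    proof -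
      have "(D *\<^sub>v v) $ i = (\<Sum>j<d. D $$ (i, j) * v $ j)"
        using D_carrier v that by (intro mult_mat_vec_index_sum)
      also have "\<dots> = D $$ (i, 0) * v $ 0 + D $$ (i, 1) * v $ 1"
        using d that by (intro sum_two_terms) (auto simp: D)
      finally show ?thesis .
    qed
    have "(cvec_norm (D *\<^sub>v v))\<^sup>2 = (\<Sum>i<d. (cmod ((D *\<^sub>v v) $ i))\<^sup>2)"
      using D_carrier by (simp add: cvec_norm_sq del: index_mult_mat_vec(1))
    also have "\<dots> = (cmod ((D *\<^sub>v v) $ 0))\<^sup>2 + (cmod ((D *\<^sub>v v) $ 1))\<^sup>2"
      using d by (intro sum_two_terms) (auto simp: Dv D simp del: index_mult_mat_vec(1))
    also have "\<dots> = s\<^sup>2 * (c\<^sup>2 + s\<^sup>2) * ((cmod (v $ 0))\<^sup>2 + (cmod (v $ 1))\<^sup>2)"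
    proof -
      \<comment> \<open>On the plane \<open>D\<close> is a scaled rotation followed by a sign flip
        of the second coordinate, which the norm ignores.\<close>
      have "(D *\<^sub>v v) $ 0 = of_real (s * s) * v $ 0 - of_real (c * s) * v $ 1"
        "(D *\<^sub>v v) $ 1 = - (of_real (c * s) * v $ 0 + of_real (s * s) * v $ 1)"
        using d by (simp_all add: Dv D del: index_mult_mat_vec(1))
      then show ?thesis
        using cmod_rotation[of "s * s" "v $ 0" "c * s" "v $ 1"]
        by (simp only: norm_minus_cancel) (simp add: power2_eq_square algebra_simps)
    qed
    finally show ?thesis by (simp add: cs)
  qed
  have "operator_norm D = s"
    unfolding operator_norm_def
  proof (rule cSup_eq_maximum)
    \<comment> \<open>The first basis vector lies in the plane, where \<open>D\<close> scales every
      norm by exactly \<open>s\<close>, so it attains the supremum.\<close>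
    have "cvec_norm (unit_vec d 0) = 1"
      using d power2_eq_iff_nonneg[of "cvec_norm (unit_vec d 0 :: complex vec)" 1]
      by (simp add: cvec_norm_sq sum_two_terms[of 1])
    moreover have "cvec_norm (D *\<^sub>v unit_vec d 0) = s"
      using d s power2_eq_iff_nonneg[of "cvec_norm (D *\<^sub>v unit_vec d 0)" s]
      by (simp add: norm_D)
    ultimately show "s \<in> (\<lambda>v. cvec_norm (D *\<^sub>v v)) ` {v \<in> carrier_vec (dim_col D). cvec_norm v = 1}"
      using D_carrier by (intro image_eqI[of _ _ "unit_vec d 0"]) auto
  next
    fix x assume "x \<in> (\<lambda>v. cvec_norm (D *\<^sub>v v)) ` {v \<in> carrier_vec (dim_col D). cvec_norm v = 1}"
    then obtain v where v: "v \<in> carrier_vec d" "cvec_norm v = 1" and x: "x = cvec_norm (D *\<^sub>v v)"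
      using D_carrier by auto
    have "x\<^sup>2 \<le> s\<^sup>2 * 1"
      unfolding x norm_D[OF v(1)] using cvec_norm_two_terms[OF v(1), of 1] d v(2)
      by (intro mult_left_mono) auto
    then show "x \<le> s" by (intro power2_le_imp_le[OF _ s]) simp
  qed
  then show ?thesis unfolding T_dist_def D_def[symmetric] trace by simp
qed

text \<open>For finite \<open>\<alpha>\<close> the factor 2 under the root only increases the value
  and is dropped. With \<open>s = 2 * \<epsilon>\<close> a single pair then meets the promise for
  all \<open>\<alpha>\<close> at once.\<close>

corollary T_dist_tilted_state_ge:
  assumes "2 \<le> d" "c\<^sup>2 + s\<^sup>2 = 1" "0 \<le> s" "1 \<le> \<alpha>"
  shows "s / 2 \<le> T_dist \<alpha> (ketbra (tilted_state d 1 0)) (ketbra (tilted_state d c s))"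
proof (cases \<alpha>)
  case (real r)
  then have r: "1 \<le> r" using assms(4) by simp
  have "s = (s powr r) powr (1 / r)" using assms(3) r by (simp add: powr_powr)
  also have "\<dots> \<le> (2 * s powr r) powr (1 / r)" using r by (intro powr_mono2) auto
  finally show ?thesis using assms real by (simp add: T_dist_tilted_state)
qed (use assms in \<open>auto simp: T_dist_tilted_state\<close>)

corollary T_dist_tilted_state_self:
  "2 \<le> d \<Longrightarrow> T_dist \<alpha> (ketbra (tilted_state d 1 0)) (ketbra (tilted_state d 1 0)) = 0"
  by (simp add: T_dist_tilted_state)

section \<open>Lower bounds\<close>

lemma le_ereal_of_enat_Inf:
  assumes "\<And>k. enat k \<in> S \<Longrightarrow> x \<le> real k"
  shows "ereal x \<le> ereal_of_enat (Inf S)"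
proof (cases "Inf S")
  case (enat k)
  \<comment> \<open>A finite infimum excludes the empty set, whose infimum is infinite; it is then
    attained, because the order is well-founded.\<close>
  then have "S \<noteq> {}" by (auto simp: Inf_enat_def)
  then have "enat k \<in> S" by (metis enat Inf_enat_def LeastI ex_in_conv)
  then show ?thesis using assms enat by simp
qed simp

text \<open>The sine \<open>2 * \<epsilon>\<close> is what \<open>T_dist_tilted_state_ge\<close>
  asks for. From \<open>c\<^sup>2 \<le> c\<close> on the unit interval one gets
  \<open>1 - c \<le> 1 - c\<^sup>2 = 4 * \<epsilon>\<^sup>2\<close>.\<close>

lemma cosine_of_sine:
  fixes \<epsilon> :: real
  assumes "0 < \<epsilon>" "\<epsilon> < 1 / 4"
  obtains c where "0 \<le> c" "c\<^sup>2 + (2 * \<epsilon>)\<^sup>2 = 1" "1 - c \<le> 4 * \<epsilon>\<^sup>2" "c \<le> 1"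
proof
  have e: "\<epsilon>\<^sup>2 \<le> (1 / 4)\<^sup>2" using assms by (intro power_mono) auto
  define c where "c = sqrt (1 - 4 * \<epsilon>\<^sup>2)"
  have c2: "c\<^sup>2 = 1 - 4 * \<epsilon>\<^sup>2" using e by (simp add: c_def power2_eq_square)
  show c0: "0 \<le> c" and c1: "c \<le> 1" using e by (simp_all add: c_def power2_eq_square)
  show "c\<^sup>2 + (2 * \<epsilon>)\<^sup>2 = 1" using c2 by (simp add: power2_eq_square)
  have "c\<^sup>2 \<le> c" using c0 c1 by (simp add: power2_eq_square mult_left_le)
  then show "1 - c \<le> 4 * \<epsilon>\<^sup>2" using c2 by simp
qed

lemma query_lower_bound:
  assumes solves: "solves_with_queries n m \<alpha> \<epsilon> \<A>"
    and \<alpha>: "1 \<le> \<alpha>" and \<epsilon>: "0 < \<epsilon>" "\<epsilon> < 1 / 4" and n: "1 \<le> n"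
  shows "1 / 12 / \<epsilon> \<le> length (rounds \<A>)"
proof -
  obtain c where c: "0 \<le> c" "c\<^sup>2 + (2 * \<epsilon>)\<^sup>2 = 1" "1 - c \<le> 4 * \<epsilon>\<^sup>2" "c \<le> 1"
    using cosine_of_sine[OF \<epsilon>] by blast
  define N :: nat where "N = 2 ^ (n + m)"
  define dim where "dim = total_dim n m \<A>"
  define R where "R = plane_rotation N (2 ^ m) c (2 * \<epsilon>)"
  define K where "K = sqrt (2 - 2 * c)"
  define \<psi> where "\<psi> = tilted_state (2 ^ n) 1 0"
  define \<phi> where "\<phi> = tilted_state (2 ^ n) c (2 * \<epsilon>)"
  define v where "v = final_state n m \<A> (1\<^sub>m N) (1\<^sub>m N)"
  define w where "w = final_state n m \<A> (1\<^sub>m N) R"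
  have "(2::nat) ^ 1 \<le> 2 ^ n" using n by (intro power_increasing) auto
  then have n2: "(2::nat) \<le> 2 ^ n" by simp
  have mN: "(2::nat) ^ m < N" unfolding N_def using n by (intro power_strict_increasing) auto
  \<comment> \<open>Here \<open>K\<^sup>2 = 2 * (1 - c)\<close>, which is where the factor 8 comes
    from.\<close>
  have K: "0 \<le> K" "K\<^sup>2 \<le> 8 * \<epsilon>\<^sup>2" using c by (auto simp: K_def)
  have valid: "unitary_mat dim (first_unitary \<A>)" "\<And>U. U \<in> snd ` set (rounds \<A>) \<Longrightarrow> unitary_mat dim U"
    "effect dim (final_effect \<A>)"
    using solves by (auto simp: solves_with_queries_def valid_query_algorithm_def dim_def)
  have R: "unitary_mat N R" "near_one N K R"
    unfolding R_def K_def using mN c(2) by (auto intro: unitary_mat_plane_rotation near_one_plane_rotation)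
  have dim: "dim = 2 * N * 2 ^ work_qubits \<A>"
    by (simp add: dim_def total_dim_def N_def power_add)
  have pure: "pure_state n \<psi>" "pure_state n \<phi>"
    unfolding \<psi>_def \<phi>_def using n c(2) by (auto intro: pure_state_tilted_state)
  have access: "purified_access n m (1\<^sub>m N) (ketbra \<psi>)" "purified_access n m R (ketbra \<phi>)"
    \<comment> \<open>The rotation by angle 0 is the identity, so the identity oracle prepares the
      reference state.\<close>
    using purified_access_plane_rotation[OF n, of 1 0 m] purified_access_plane_rotation[OF n c(2), of m]
    by (simp_all add: N_def R_def \<psi>_def \<phi>_def plane_rotation_trivial)
  have no: "outcome_prob (1\<^sub>m dim - final_effect \<A>) (ketbra v) \<ge> 2 / 3"
    using solves pure(1) access(1) T_dist_tilted_state_self[OF n2]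
    by (auto simp: solves_with_queries_def answers_correctly_def dim_def v_def \<psi>_def)
  have "\<epsilon> \<le> T_dist \<alpha> (ketbra \<psi>) (ketbra \<phi>)"
    using T_dist_tilted_state_ge[OF n2 c(2) _ \<alpha>] \<epsilon> by (simp add: \<psi>_def \<phi>_def)
  then have yes: "outcome_prob (final_effect \<A>) (ketbra w) \<ge> 2 / 3"
    using solves pure access
    by (auto simp: solves_with_queries_def answers_correctly_def w_def)
  define x where "x = first_unitary \<A> *\<^sub>v unit_vec dim 0"
  have "dim > 0" by (simp add: dim_def total_dim_def)
  then have "cvec_norm (unit_vec dim 0) = 1" by (simp add: cvec_norm_def)
  then have "cvec_norm x = 1"
    using valid(1) by (simp add: x_def cvec_norm_unitary)
  moreover have "x \<in> carrier_vec dim"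
    using valid(1) by (auto simp: x_def unitary_mat_def intro!: mult_mat_vec_carrier)
  \<comment> \<open>In the run on the equal pair both oracles are identities, so its constant is 0
    and only the other run contributes error.\<close>
  moreover have gates: "near_one dim K (query_gate (work_qubits \<A>) (1\<^sub>m N) R q)"
    "near_one dim 0 (query_gate (work_qubits \<A>) (1\<^sub>m N) (1\<^sub>m N) q)" for q
    unfolding dim using K R by (auto intro!: near_one_query_gate near_one_one unitary_mat_one)
  ultimately have vw: "w \<in> carrier_vec dim" "v \<in> carrier_vec dim" "cvec_norm v \<le> 1"
    "cvec_norm (w - v) \<le> cvec_norm (x - x) + length (rounds \<A>) * (K + 0)"
    unfolding w_def v_def final_state_def x_def[symmetric] dim_def[symmetric]
    using cvec_norm_foldl_queries[OF valid(2) gates, of "rounds \<A>" x x] K(1) by auto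
  have "cvec_norm (x - x) = 0"
    by (simp add: cvec_norm_L2_set L2_set_def)
  then have "cvec_norm (w - v) \<le> length (rounds \<A>) * K" using vw(4) by simp
  then have "(cvec_norm (w - v))\<^sup>2 \<le> (length (rounds \<A>) * K)\<^sup>2"
    by (intro power_mono) auto
  moreover have "1 / 18 \<le> (cvec_norm (w - v))\<^sup>2"
    using effect_discrimination[OF valid(3) vw(2,1,3) no yes] .
  moreover have "(length (rounds \<A>) * K)\<^sup>2 \<le> (length (rounds \<A>))\<^sup>2 * (8 * \<epsilon>\<^sup>2)"
    using K(2) by (simp add: power_mult_distrib mult_left_mono)
  \<comment> \<open>The constant is \<open>1 / (18 * 8) = (1 / 12)\<^sup>2\<close>.\<close>
  ultimately have "(1 / 12)\<^sup>2 \<le> (length (rounds \<A>) * \<epsilon>)\<^sup>2"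
    by (simp add: power2_eq_square algebra_simps)
  then have "1 / 12 \<le> length (rounds \<A>) * \<epsilon>"
    by (rule power2_le_imp_le) (use \<epsilon>(1) in simp)
  then show ?thesis using \<epsilon>(1) by (simp add: divide_le_eq)
qed

section \<open>Product vectors for many copies\<close>

definition tensor_vec :: "complex vec \<Rightarrow> complex vec \<Rightarrow> complex vec" where
  "tensor_vec u v = vec (dim_vec u * dim_vec v) (\<lambda>i. u $ (i div dim_vec v) * v $ (i mod dim_vec v))"

fun tensor_power :: "complex vec \<Rightarrow> nat \<Rightarrow> complex vec" where
  "tensor_power u 0 = unit_vec 1 0"
| "tensor_power u (Suc k) = tensor_vec u (tensor_power u k)"

lemma tensor_vec_carrier [simp]:
  "u \<in> carrier_vec a \<Longrightarrow> v \<in> carrier_vec b \<Longrightarrow> tensor_vec u v \<in> carrier_vec (a * b)"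
  by (auto simp: tensor_vec_def)

lemma tensor_power_carrier [simp]: "u \<in> carrier_vec a \<Longrightarrow> tensor_power u k \<in> carrier_vec (a ^ k)"
  by (induction k) auto

text \<open>Both products split an index in the same way. Joint copies of pure states thus become
  vectors, to which \<open>effect_discrimination\<close> applies.\<close>

lemma ketbra_tensor_vec: "ketbra (tensor_vec u v) = kron (ketbra u) (ketbra v)"
proof (rule eq_matI)
  fix i j assume "i < dim_row (kron (ketbra u) (ketbra v))" "j < dim_col (kron (ketbra u) (ketbra v))"
  then have ij: "i < dim_vec u * dim_vec v" "j < dim_vec u * dim_vec v"
    by (simp_all add: kron_def ketbra_def)
  then have "0 < dim_vec v" by (cases "dim_vec v") auto
  with ij show "ketbra (tensor_vec u v) $$ (i, j) = kron (ketbra u) (ketbra v) $$ (i, j)"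
    by (simp add: kron_def ketbra_def tensor_vec_def less_mult_imp_div_less)
qed (simp_all add: kron_def ketbra_def tensor_vec_def)

lemma ketbra_tensor_power: "ketbra (tensor_power u k) = kron_power (ketbra u) k"
proof (induction k)
  case 0
  show ?case by (rule eq_matI) (auto simp: ketbra_def)
qed (simp add: ketbra_tensor_vec)

lemma cscalar_prod_tensor_vec:
  assumes "u \<in> carrier_vec a" "u' \<in> carrier_vec a" "v \<in> carrier_vec b" "v' \<in> carrier_vec b"
  shows "tensor_vec u v \<bullet>c tensor_vec u' v' = (u \<bullet>c u') * (v \<bullet>c v')"
proof -
  have "tensor_vec u v \<bullet>c tensor_vec u' v'
      = (\<Sum>i<a. \<Sum>k<b. (u $ i * cnj (u' $ i)) * (v $ k * cnj (v' $ k)))"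
    using assms by (subst cscalar_prod_sum[of _ "a * b"])
      (auto simp: sum_lessThan_mult tensor_vec_def pair_index_less intro!: sum.cong)
  also have "\<dots> = (u \<bullet>c u') * (v \<bullet>c v')"
    using assms by (simp add: cscalar_prod_sum[of _ a] cscalar_prod_sum[of _ b] sum_product)
  finally show ?thesis .
qed

lemma cscalar_prod_tensor_power:
  assumes "u \<in> carrier_vec a" "v \<in> carrier_vec a"
  shows "tensor_power u k \<bullet>c tensor_power v k = (u \<bullet>c v) ^ k"
proof (induction k)
  case (Suc k)
  then show ?case
    using assms by (simp add: cscalar_prod_tensor_vec[where a = a and b = "a ^ k"])
qed simp

lemma cvec_norm_diff_sq:
  assumes "v \<in> carrier_vec d" "w \<in> carrier_vec d"
  shows "(cvec_norm (v - w))\<^sup>2 = (cvec_norm v)\<^sup>2 + (cvec_norm w)\<^sup>2 - 2 * Re (v \<bullet>c w)"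
proof -
  have "(cvec_norm (v - w))\<^sup>2 = (\<Sum>i<d. (cmod (v $ i - w $ i))\<^sup>2)"
    using assms by (simp add: cvec_norm_sq)
  also have "\<dots> = (\<Sum>i<d. (cmod (v $ i))\<^sup>2 + (cmod (w $ i))\<^sup>2 - 2 * Re (v $ i * cnj (w $ i)))"
    by (intro sum.cong refl, unfold cmod_power2) (simp add: power2_eq_square algebra_simps)
  finally show ?thesis
    using assms by (simp add: cvec_norm_sq cscalar_prod_sum[of _ d] sum.distrib sum_subtractf sum_distrib_left)
qed

text \<open>Both instances share their first state, so its \<open>k0\<close> copies do not help to
  tell them apart, and the bound falls on \<open>k1\<close> alone.\<close>

lemma sample_lower_bound:
  assumes solves: "solves_with_samples n \<alpha> \<epsilon> k0 k1 E"
    and \<alpha>: "1 \<le> \<alpha>" and \<epsilon>: "0 < \<epsilon>" "\<epsilon> < 1 / 4" and n: "1 \<le> n"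
  shows "1 / 144 / \<epsilon>\<^sup>2 \<le> k1"
proof -
  obtain c where c: "0 \<le> c" "c\<^sup>2 + (2 * \<epsilon>)\<^sup>2 = 1" "1 - c \<le> 4 * \<epsilon>\<^sup>2" "c \<le> 1"
    using cosine_of_sine[OF \<epsilon>] by blast
  define N :: nat where "N = 2 ^ n"
  define dim :: nat where "dim = 2 ^ (n * (k0 + k1))"
  define \<psi> where "\<psi> = tilted_state N 1 0"
  define \<phi> where "\<phi> = tilted_state N c (2 * \<epsilon>)"
  define v where "v = tensor_vec (tensor_power \<psi> k0) (tensor_power \<psi> k1)"
  define w where "w = tensor_vec (tensor_power \<psi> k0) (tensor_power \<phi> k1)"
  have "(2::nat) ^ 1 \<le> 2 ^ n" using n by (intro power_increasing) auto
  then have n2: "2 \<le> N" by (simp add: N_def)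
  have carr: "\<psi> \<in> carrier_vec N" "\<phi> \<in> carrier_vec N" by (simp_all add: \<psi>_def \<phi>_def tilted_state_def)
  have dim: "dim = N ^ k0 * N ^ k1" by (simp add: dim_def N_def power_mult power_add)
  have vw: "v \<in> carrier_vec dim" "w \<in> carrier_vec dim" by (simp_all add: v_def w_def dim carr)
  have scalar: "\<psi> \<bullet>c \<psi> = 1" "\<phi> \<bullet>c \<psi> = of_real c" "\<phi> \<bullet>c \<phi> = 1"
    using n2 c(2) by (simp_all add: \<psi>_def \<phi>_def cscalar_prod_tilted_state power2_eq_square)
  \<comment> \<open>The \<open>k0\<close> copies contribute the factor 1 to every inner
    product.\<close>
  have "v \<bullet>c v = 1" "w \<bullet>c w = 1" and wv: "w \<bullet>c v = of_real (c ^ k1)"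
    unfolding v_def w_def using carr
    by (simp_all add: cscalar_prod_tensor_vec[of _ "N ^ k0" _ _ "N ^ k1"] cscalar_prod_tensor_power[of _ N] scalar)
  then have norm: "cvec_norm v = 1" "cvec_norm w = 1" by (simp_all add: cvec_norm_def)
  have pure: "pure_state n \<psi>" "pure_state n \<phi>"
    unfolding \<psi>_def \<phi>_def N_def using n c(2) by (auto intro: pure_state_tilted_state)
  have no: "outcome_prob (1\<^sub>m dim - E) (ketbra v) \<ge> 2 / 3"
    using solves pure(1) T_dist_tilted_state_self[OF n2]
    by (auto simp: solves_with_samples_def answers_correctly_def dim_def v_def \<psi>_def
        ketbra_tensor_vec ketbra_tensor_power)
  have "\<epsilon> \<le> T_dist \<alpha> (ketbra \<psi>) (ketbra \<phi>)"
    using T_dist_tilted_state_ge[OF n2 c(2) _ \<alpha>] \<epsilon> by (simp add: \<psi>_def \<phi>_def)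
  then have yes: "outcome_prob E (ketbra w) \<ge> 2 / 3"
    using solves pure
    by (auto simp: solves_with_samples_def answers_correctly_def w_def ketbra_tensor_vec ketbra_tensor_power)
  have "effect dim E" using solves by (simp add: solves_with_samples_def dim_def)
  then have "1 / 18 \<le> (cvec_norm (w - v))\<^sup>2"
    using effect_discrimination vw norm no yes by simp
  also have "\<dots> = 2 - 2 * c ^ k1"
    using vw by (simp add: cvec_norm_diff_sq[of _ dim] norm wv)
  \<comment> \<open>Bernoulli: \<open>c ^ k1 \<ge> 1 - k1 * (1 - c)\<close>.\<close>
  also have "\<dots> \<le> 2 * (k1 * (1 - c))"
    using Bernoulli_inequality[of "c - 1" k1] c(1) by (simp add: algebra_simps)
  also have "\<dots> \<le> 2 * (k1 * (4 * \<epsilon>\<^sup>2))"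
    using c(3) by (intro mult_left_mono) auto
  \<comment> \<open>The chain reads \<open>1 / 18 \<le> 8 * k1 * \<epsilon>\<^sup>2\<close>, hence
    the constant \<open>1 / 144\<close>.\<close>
  finally show ?thesis using \<epsilon>(1) by (simp add: divide_le_eq algebra_simps)
qed

theorem theorem5p6:
  shows "(\<exists>c>0. \<forall>(\<alpha>::ereal) (\<epsilon>::real) (n::nat) (m::nat).
            1 \<le> \<alpha> \<longrightarrow> 0 < \<epsilon> \<longrightarrow> \<epsilon> < 1 / 4 \<longrightarrow> 1 \<le> n \<longrightarrow>
            ereal (c / \<epsilon>) \<le> ereal_of_enat (query_complexity n m \<alpha> \<epsilon>))
       \<and> (\<exists>c>0. \<forall>(\<alpha>::ereal) (\<epsilon>::real) (n::nat).
            1 \<le> \<alpha> \<longrightarrow> 0 < \<epsilon> \<longrightarrow> \<epsilon> < 1 / 4 \<longrightarrow> 1 \<le> n \<longrightarrow>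
            ereal (c / \<epsilon>\<^sup>2) \<le> ereal_of_enat (sample_complexity n \<alpha> \<epsilon>))"
proof (rule conjI)
  show "\<exists>c>0. \<forall>(\<alpha>::ereal) (\<epsilon>::real) (n::nat) (m::nat).
      1 \<le> \<alpha> \<longrightarrow> 0 < \<epsilon> \<longrightarrow> \<epsilon> < 1 / 4 \<longrightarrow> 1 \<le> n \<longrightarrow>
      ereal (c / \<epsilon>) \<le> ereal_of_enat (query_complexity n m \<alpha> \<epsilon>)"
    unfolding query_complexity_def
    \<comment> \<open>The constant of \<open>query_lower_bound\<close> is uniform in all parameters.
      The disabled rewrite rule keeps the nested quotient in the form of that lemma.\<close>
    by (rule exI[of _ "1 / 12"]) (auto intro!: le_ereal_of_enat_Inf query_lower_bound simp del: divide_divide_eq_left)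
  show "\<exists>c>0. \<forall>(\<alpha>::ereal) (\<epsilon>::real) (n::nat).
      1 \<le> \<alpha> \<longrightarrow> 0 < \<epsilon> \<longrightarrow> \<epsilon> < 1 / 4 \<longrightarrow> 1 \<le> n \<longrightarrow>
      ereal (c / \<epsilon>\<^sup>2) \<le> ereal_of_enat (sample_complexity n \<alpha> \<epsilon>)"
    unfolding sample_complexity_def
    \<comment> \<open>The bound on \<open>k1\<close> passes to the total number
      \<open>k0 + k1\<close> by transitivity.\<close>
    by (rule exI[of _ "1 / 144"])
      (auto intro!: le_ereal_of_enat_Inf order_trans[OF sample_lower_bound] simp del: divide_divide_eq_left)
qed

end
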